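(* Let $n$ be an odd number, $h_n:=(n-1)/2$, and let $\ell$ be an integer with $0\le\ell\le h_n-1$. Let $U\subseteq\mathbb R^{n+1}$ be an axially symmetric open set and $f$ a left (resp. right) slice hyperholomorphic function on $U$. Then $\Delta_{n+1}^\ell\overline D^{\,h_n-\ell}f$ (resp. $f\,\Delta_{n+1}^\ell\overline D^{\,h_n-\ell}$, with $\overline D$ acting from the right) is a left (resp. right) axially polyanalytic function of order $h_n-\ell+1$ on $U$.
   Context: $\mathbb R_n$ is the real Clifford algebra generated by $e_1,\dots,e_n$ with $e_ie_j+e_je_i=-2\delta_{ij}$. A point $(x_0,\dots,x_n)\in\mathbb R^{n+1}$ is identified with the paravector $x=x_0+\underline x$, $\underline x=\sum_{j=1}^n x_je_j$. $\mathbb S$ is the set of $\underline x$ with $|\underline x|=1$. $[x]=\{x_0+I|\underline x|: I\in\mathbb S\}$. An open $U\subset\mathbb R^{n+1}$ is axially symmetric if $[x]\subset U$ for all $x\in U$. For such $U$ let $\mathcal U=\{(u,v)\in\mathbb R^2: u+\mathbb S v\subset U\}$. $f:U\to\mathbb R_n$ is left (resp. right) slice hyperholomorphic if $f(u+Iv)=\alpha(u,v)+I\beta(u,v)$ (resp. $\alpha(u,v)+\beta(u,v)I$) for all $I\in\mathbb S$, $(u,v)\in\mathcal U$, with differentiable $\alpha,\beta:\mathcal U\to\mathbb R_n$ satisfying $\alpha(u,-v)=\alpha(u,v)$, $\beta(u,-v)=-\beta(u,v)$ and $\partial_u\alpha=\partial_v\beta$, $\partial_v\alpha=-\partial_u\beta$.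 $Df=\partial_{x_0}f+\sum_{i=1}^ne_i\partial_{x_i}f$, $\overline Df=\partial_{x_0}f-\sum_{i=1}^ne_i\partial_{x_i}f$; acting from the right, $fD=\partial_{x_0}f+\sum_i\partial_{x_i}f\,e_i$, $f\overline D=\partial_{x_0}f-\sum_i\partial_{x_i}f\,e_i$. $\Delta_{n+1}=\sum_{j=0}^n\partial_{x_j}^2$. For $m\ge1$, a function $g:U\to\mathbb R_n$ of class $\mathcal C^m$ is left (resp. right) axially polyanalytic of order $m$ if $D^mg=0$ (resp. $gD^m=0$) on $U$ and $g$ is of left (resp. right) axial form: $g(x)=A(x_0,|\underline x|)+\underline\omega B(x_0,|\underline x|)$ (resp. $A+B\underline\omega$), $\underline\omega=\underline x/|\underline x|$, with $\mathbb R_n$-valued $A$ even and $B$ odd in the second variable. *)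

theory Defs
  imports "HOL-Analysis.Analysis"
begin

section \<open>The real Clifford algebra with \<open>n\<close> anticommuting square roots of \<open>-1\<close>\<close>

text \<open>
  The index type \<open>'n\<close> plays the role of \<open>{1, \<dots>, n}\<close>.
  An element is its coefficient vector in the basis of blades \<open>e\<^sub>A\<close>
  (the product of the \<open>e\<^sub>i\<close>, \<open>i \<in> A\<close>, in increasing order), where \<open>A\<close> ranges over all sets of
  indices. The linear order on \<open>'n\<close> enters only through the product.
  A copy of the vector type is needed since \<open>*\<close> on vectors is componentwise.
\<close>

typedef (overloaded) ('n::finite) clifford = "UNIV :: (real ^ 'n set) set"
  morphisms coeffs of_coeffs
  by simp

setup_lifting type_definition_clifford

instantiation clifford :: (finite) real_vector
begin

lift_definition zero_clifford :: "'a clifford" is 0 .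
lift_definition plus_clifford :: "'a clifford \<Rightarrow> 'a clifford \<Rightarrow> 'a clifford" is "(+)" .
lift_definition minus_clifford :: "'a clifford \<Rightarrow> 'a clifford \<Rightarrow> 'a clifford" is "(-)" .
lift_definition uminus_clifford :: "'a clifford \<Rightarrow> 'a clifford" is uminus .
lift_definition scaleR_clifford :: "real \<Rightarrow> 'a clifford \<Rightarrow> 'a clifford" is scaleR .

instance
  by standard (transfer; simp add: algebra_simps)+

end

instantiation clifford :: (finite) real_inner
begin

lift_definition inner_clifford :: "'a clifford \<Rightarrow> 'a clifford \<Rightarrow> real" is inner .
lift_definition norm_clifford :: "'a clifford \<Rightarrow> real" is norm .
definition dist_clifford :: "'a clifford \<Rightarrow> 'a clifford \<Rightarrow> real"
  where "dist_clifford a b = norm (a - b)"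
definition sgn_clifford :: "'a clifford \<Rightarrow> 'a clifford"
  where "sgn_clifford a = a /\<^sub>R norm a"
definition uniformity_clifford :: "('a clifford \<times> 'a clifford) filter"
  where "uniformity_clifford = (INF e\<in>{0 <..}. principal {(a, b). dist a b < e})"
definition open_clifford :: "'a clifford set \<Rightarrow> bool"
  where "open_clifford S \<longleftrightarrow> (\<forall>a\<in>S. \<forall>\<^sub>F (a', b) in uniformity. a' = a \<longrightarrow> b \<in> S)"

instance
proof
  fix a b c :: "'a clifford" and r :: real and S :: "'a clifford set"
  show "inner a b = inner b a" by transfer (rule inner_commute)
  show "inner (a + b) c = inner a c + inner b c" by transfer (rule inner_add_left)
  show "inner (r *\<^sub>R a) b = r * inner a b" by transfer simp
  show "0 \<le> inner a a" by transfer simp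
  show "(inner a a = 0) = (a = 0)" by transfer simp
  show "norm a = sqrt (inner a a)" by transfer (rule norm_eq_sqrt_inner)
qed (simp_all add: dist_clifford_def sgn_clifford_def uniformity_clifford_def open_clifford_def)

end

instantiation clifford :: (finite) euclidean_space
begin

lift_definition Basis_clifford :: "'a clifford set" is Basis .

instance
proof
  show "(Basis :: 'a clifford set) \<noteq> {}" by transfer simp
  show "finite (Basis :: 'a clifford set)" by transfer simp
  fix u v x :: "'a clifford"
  show "u \<in> Basis \<Longrightarrow> v \<in> Basis \<Longrightarrow> inner u v = (if u = v then 1 else 0)"
    by transfer (simp add: inner_Basis)
  show "(\<forall>u\<in>Basis. inner x u = 0) = (x = 0)"
    by transfer (simp add: euclidean_all_zero_iff)
qed

end

text \<open>
  Sorting the juxtaposition of \<open>e\<^sub>A\<close> and \<open>e\<^sub>B\<close> produces one factor \<open>-1\<close> for each pair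
  \<open>i \<in> A\<close>, \<open>j \<in> B\<close> with \<open>j < i\<close> (anticommutation) and one for each common index
  (\<open>e\<^sub>i\<^sup>2 = -1\<close>); hence \<open>e\<^sub>A e\<^sub>B = blade_sign A B e\<^sub>C\<close> with \<open>C\<close> the symmetric difference.
\<close>

definition blade_sign :: "'n::{finite,linorder} set \<Rightarrow> 'n set \<Rightarrow> real"
  where "blade_sign A B = (\<Prod>i\<in>A. \<Prod>j\<in>B. if j \<le> i then - 1 else 1)"

lemma blade_sign_empty [simp]: "blade_sign {} B = 1" "blade_sign A {} = 1"
  by (simp_all add: blade_sign_def)

lemma prod_sym_diff_signs:
  fixes f :: "'n::finite \<Rightarrow> real"
  assumes "\<And>i. f i * f i = 1"
  shows "prod f (sym_diff A B) = prod f A * prod f B"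
proof -
  have 1: "prod f A = prod f (A - B) * prod f (A \<inter> B)" for A B
    by (subst prod.union_disjoint [symmetric]) (auto intro: prod.cong)
  have 2: "prod f (A \<inter> B) * prod f (A \<inter> B) = 1"
    by (simp add: prod.distrib [symmetric] assms)
  have "prod f (sym_diff A B) = prod f (A - B) * prod f (B - A)"
    by (rule prod.union_disjoint) auto
  also have "\<dots> = prod f (A - B) * prod f (B - A) * (prod f (A \<inter> B) * prod f (A \<inter> B))"
    by (simp add: 2)
  also have "\<dots> = prod f A * prod f B"
    by (simp add: 1[of A B] 1[of B A] Int_commute mult_ac)
  finally show ?thesis .
qed

lemma blade_sign_square: "blade_sign A B * blade_sign A B = 1"
  unfolding blade_sign_def prod.distrib [symmetric] by (intro prod.neutral ballI) simp

lemma blade_sign_sym_diff_left: "blade_sign (sym_diff A B) C = blade_sign A C * blade_sign B C"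
  unfolding blade_sign_def
  by (rule prod_sym_diff_signs)
    (unfold prod.distrib [symmetric], intro prod.neutral ballI, simp)

lemma blade_sign_sym_diff_right: "blade_sign A (sym_diff B C) = blade_sign A B * blade_sign A C"
proof -
  have "(\<Prod>j\<in>sym_diff B C. if j \<le> i then - 1 else 1 :: real)
      = (\<Prod>j\<in>B. if j \<le> i then - 1 else 1) * (\<Prod>j\<in>C. if j \<le> i then - 1 else 1)" for i
    by (rule prod_sym_diff_signs) simp
  thus ?thesis by (simp add: blade_sign_def prod.distrib)
qed

lemma sum_sym_diff_reindex:
  fixes g :: "'n::finite set \<Rightarrow> 'b::comm_monoid_add"
  shows "(\<Sum>B\<in>UNIV. g (sym_diff A B)) = (\<Sum>B\<in>UNIV. g B)"
  by (rule sum.reindex_bij_witness[of _ "sym_diff A" "sym_diff A"]) auto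

instantiation clifford :: ("{finite,linorder}") real_algebra_1
begin

lift_definition one_clifford :: "'a clifford" is "axis {} 1" .

lift_definition times_clifford :: "'a clifford \<Rightarrow> 'a clifford \<Rightarrow> 'a clifford"
  is "\<lambda>a b. \<chi> C. \<Sum>A\<in>UNIV. blade_sign A (sym_diff A C) * (a $ A) * (b $ sym_diff A C)" .

instance
proof
  fix a b c :: "'a clifford" and r :: real
  have sd: "sym_diff A (sym_diff A B) = B" for A B :: "'a set" by auto
  show "a * b * c = a * (b * c)"
  proof (transfer, subst vec_eq_iff, intro allI, goal_cases)
    case (1 a b c D)
    let ?s = "blade_sign :: 'a set \<Rightarrow> 'a set \<Rightarrow> real"
    have "(\<Sum>E\<in>UNIV. ?s E (sym_diff E D)
              * (\<Sum>A\<in>UNIV. ?s A (sym_diff A E) * a $ A * b $ sym_diff A E) * c $ sym_diff E D)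
        = (\<Sum>E\<in>UNIV. \<Sum>A\<in>UNIV. ?s E (sym_diff E D) * ?s A (sym_diff A E)
              * a $ A * b $ sym_diff A E * c $ sym_diff E D)"
      by (simp add: sum_distrib_left sum_distrib_right mult.assoc)
    also have "\<dots> = (\<Sum>A\<in>UNIV. \<Sum>E\<in>UNIV. ?s E (sym_diff E D) * ?s A (sym_diff A E)
              * a $ A * b $ sym_diff A E * c $ sym_diff E D)"
      by (rule sum.swap)
    also have "\<dots> = (\<Sum>A\<in>UNIV. \<Sum>B\<in>UNIV. ?s (sym_diff A B) (sym_diff (sym_diff A B) D)
              * ?s A (sym_diff A (sym_diff A B))
              * a $ A * b $ sym_diff A (sym_diff A B) * c $ sym_diff (sym_diff A B) D)"
      by (intro sum.cong refl sum_sym_diff_reindex [symmetric])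
    also have "\<dots> = (\<Sum>A\<in>UNIV. \<Sum>B\<in>UNIV. ?s A (sym_diff A D) * a $ A *
              (?s B (sym_diff B (sym_diff A D)) * b $ B * c $ sym_diff B (sym_diff A D)))"
    proof (intro sum.cong refl, goal_cases)
      case (1 A B)
      define X where "X = sym_diff (sym_diff A B) D"
      have X: "sym_diff B (sym_diff A D) = X" "sym_diff A D = sym_diff B X"
        by (auto simp: X_def)
      have "?s (sym_diff A B) X * ?s A B = ?s A (sym_diff B X) * ?s B X"
        by (simp only: blade_sign_sym_diff_left blade_sign_sym_diff_right mult_ac)
      hence "?s (sym_diff A B) X * ?s A B * a $ A * b $ B * c $ X
          = ?s A (sym_diff B X) * a $ A * (?s B X * b $ B * c $ X)"
        by (simp only: mult_ac)
      thus ?case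
        by (simp only: sd X(1) X_def [symmetric]) (simp only: X(2))
    qed
    finally show ?case by (simp add: sum_distrib_left)
  qed
  show "(a + b) * c = a * c + b * c"
    by transfer (simp add: vec_eq_iff algebra_simps sum.distrib)
  show "a * (b + c) = a * b + a * c"
    by transfer (simp add: vec_eq_iff algebra_simps sum.distrib)
  show "r *\<^sub>R a * b = r *\<^sub>R (a * b)"
    by transfer (simp add: vec_eq_iff sum_distrib_left mult_ac)
  show "a * r *\<^sub>R b = r *\<^sub>R (a * b)"
    by transfer (simp add: vec_eq_iff sum_distrib_left mult_ac)
  show "1 * a = a"
  proof (transfer, subst vec_eq_iff, intro allI, goal_cases)
    case (1 a C)
    have "(\<Sum>A\<in>UNIV. blade_sign A (sym_diff A C) * axis {} 1 $ A * a $ sym_diff A C)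
        = (\<Sum>A\<in>{{}}. blade_sign A (sym_diff A C) * axis {} 1 $ A * a $ sym_diff A C)"
      by (rule sum.mono_neutral_right) (auto simp: axis_def)
    thus ?case by (simp add: axis_def)
  qed
  show "a * 1 = a"
  proof (transfer, subst vec_eq_iff, intro allI, goal_cases)
    case (1 a C)
    have "(\<Sum>A\<in>UNIV. blade_sign A (sym_diff A C) * a $ A * axis {} 1 $ sym_diff A C)
        = (\<Sum>A\<in>{C}. blade_sign A (sym_diff A C) * a $ A * axis {} 1 $ sym_diff A C)"
      by (rule sum.mono_neutral_right) (auto simp: axis_def)
    thus ?case by (simp add: axis_def)
  qed
  show "(0::'a clifford) \<noteq> 1"
    by transfer (simp add: vec_eq_iff axis_def)
qed

end

lift_definition blade :: "'n::finite set \<Rightarrow> 'n clifford" is "\<lambda>A. axis A 1" .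

abbreviation e_gen :: "'n::finite \<Rightarrow> 'n clifford"
  where "e_gen i \<equiv> blade {i}"

lemma blade_mult: "blade A * blade B = blade_sign A B *\<^sub>R blade (sym_diff A B)"
proof (transfer, subst vec_eq_iff, intro allI, goal_cases)
  case (1 A B C)
  have "(\<Sum>A'\<in>UNIV. blade_sign A' (sym_diff A' C) * axis A 1 $ A' * axis B 1 $ sym_diff A' C)
      = (\<Sum>A'\<in>{A}. blade_sign A' (sym_diff A' C) * axis A 1 $ A' * axis B 1 $ sym_diff A' C)"
    by (rule sum.mono_neutral_right) (auto simp: axis_def)
  moreover have "sym_diff A C = B \<longleftrightarrow> C = sym_diff A B" by auto
  ultimately show ?case by (auto simp: axis_def)
qed

text \<open>
  The following facts certify that this is the algebra intended: the defining relations hold,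
  the blades are the ordered products of the generators, and they form a basis, so that the
  dimension is \<open>2\<^sup>n\<close>.
\<close>

lemma blade_empty: "blade {} = (1 :: 'n::{finite,linorder} clifford)"
  by transfer simp

lemma e_gen_anticommute:
  "e_gen i * e_gen j + e_gen j * e_gen i = (if i = j then - 2 else 0 :: 'n::{finite,linorder} clifford)"
proof (cases "i = j")
  case True
  thus ?thesis by (simp add: blade_mult blade_sign_def blade_empty)
next
  case False
  hence "sym_diff {i} {j} = sym_diff {j} {i}" by auto
  with False show ?thesis by (auto simp: blade_mult blade_sign_def)
qed

lemma blade_insert:
  assumes "\<And>j. j \<in> A \<Longrightarrow> j < i"
  shows "blade (insert i A) = blade A * (e_gen i :: 'n::{finite,linorder} clifford)"
proof -
  have i: "i \<notin> A" using assms by blast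
  hence "sym_diff A {i} = insert i A" by auto
  moreover have "blade_sign A {i} = 1"
    unfolding blade_sign_def using assms by (intro prod.neutral ballI) (auto dest: leD)
  ultimately show ?thesis by (simp add: blade_mult)
qed

lemma Basis_clifford_eq: "(Basis :: 'n::finite clifford set) = range blade"
  by transfer (auto simp: Basis_vec_def)

lemma DIM_clifford: "DIM('n::finite clifford) = 2 ^ CARD('n)"
proof -
  have "inj (blade :: 'n set \<Rightarrow> 'n clifford)"
    by (rule injI, transfer) (simp add: axis_eq_axis)
  hence "DIM('n clifford) = card (Pow (UNIV :: 'n set))"
    by (simp add: Basis_clifford_eq card_image)
  thus ?thesis by (simp add: card_Pow)
qed


section \<open>Differential operators\<close>

text \<open>
  Functions on a domain are total functions of which only the values on that domain matter;
  all derivatives below are taken at points of open sets.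
\<close>

definition partial_deriv ::
    "'a::real_normed_vector \<Rightarrow> ('a \<Rightarrow> 'b::real_normed_vector) \<Rightarrow> 'a \<Rightarrow> 'b"
  where "partial_deriv b f x = vector_derivative (\<lambda>t. f (x + t *\<^sub>R b)) (at 0)"

text \<open>Class \<open>C\<^sup>k\<close>: all iterated partial derivatives of order at most \<open>k\<close> exist and are continuous.\<close>

primrec C_class_on ::
    "nat \<Rightarrow> ('a::euclidean_space \<Rightarrow> 'b::real_normed_vector) \<Rightarrow> 'a set \<Rightarrow> bool"
  where
    "C_class_on 0 f U \<longleftrightarrow> continuous_on U f"
  | "C_class_on (Suc k) f U \<longleftrightarrow> continuous_on U f \<and>
       (\<forall>b\<in>Basis. (\<forall>x\<in>U. (\<lambda>t. f (x + t *\<^sub>R b)) differentiable (at 0)) \<and>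
                  C_class_on k (partial_deriv b f) U)"

text \<open>
  The point \<open>(x\<^sub>0, \<dots>, x\<^sub>n)\<close> is the pair of \<open>x\<^sub>0\<close> and the vector \<open>(x\<^sub>1, \<dots>, x\<^sub>n)\<close>.
\<close>

type_synonym 'n point = "real \<times> (real ^ 'n)"

definition vec_embed :: "real ^ 'n \<Rightarrow> 'n::finite clifford"
  where "vec_embed y = (\<Sum>j\<in>UNIV. (y $ j) *\<^sub>R e_gen j)"

abbreviation partial_0 :: "('n::finite point \<Rightarrow> 'b::real_normed_vector) \<Rightarrow> 'n point \<Rightarrow> 'b"
  where "partial_0 \<equiv> partial_deriv (1, 0)"

abbreviation partial_i :: "'n::finite \<Rightarrow> ('n point \<Rightarrow> 'b::real_normed_vector) \<Rightarrow> 'n point \<Rightarrow> 'b"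
  where "partial_i i \<equiv> partial_deriv (0, axis i 1)"

definition D_left :: "('n::{finite,linorder} point \<Rightarrow> 'n clifford) \<Rightarrow> 'n point \<Rightarrow> 'n clifford"
  where "D_left f x = partial_0 f x + (\<Sum>i\<in>UNIV. e_gen i * partial_i i f x)"

definition Dbar_left :: "('n::{finite,linorder} point \<Rightarrow> 'n clifford) \<Rightarrow> 'n point \<Rightarrow> 'n clifford"
  where "Dbar_left f x = partial_0 f x - (\<Sum>i\<in>UNIV. e_gen i * partial_i i f x)"

definition D_right :: "('n::{finite,linorder} point \<Rightarrow> 'n clifford) \<Rightarrow> 'n point \<Rightarrow> 'n clifford"
  where "D_right f x = partial_0 f x + (\<Sum>i\<in>UNIV. partial_i i f x * e_gen i)"

definition Dbar_right :: "('n::{finite,linorder} point \<Rightarrow> 'n clifford) \<Rightarrow> 'n point \<Rightarrow> 'n clifford"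
  where "Dbar_right f x = partial_0 f x - (\<Sum>i\<in>UNIV. partial_i i f x * e_gen i)"

definition laplacian :: "('n::finite point \<Rightarrow> 'b::real_normed_vector) \<Rightarrow> 'n point \<Rightarrow> 'b"
  where "laplacian f x = partial_0 (partial_0 f) x + (\<Sum>i\<in>UNIV. partial_i i (partial_i i f) x)"


section \<open>Slice hyperholomorphic and axially polyanalytic functions\<close>

abbreviation unit_vectors :: "(real ^ 'n) set"
  where "unit_vectors \<equiv> sphere 0 1"

definition axial_class :: "'n::finite point \<Rightarrow> 'n point set"
  where "axial_class x = {(fst x, norm (snd x) *\<^sub>R I) | I. I \<in> unit_vectors}"

definition axially_symmetric :: "'n::finite point set \<Rightarrow> bool"
  where "axially_symmetric U \<longleftrightarrow> (\<forall>x\<in>U. axial_class x \<subseteq> U)"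

definition slice_domain :: "'n::finite point set \<Rightarrow> (real \<times> real) set"
  where "slice_domain U = {(u, v). \<forall>I\<in>unit_vectors. (u, v *\<^sub>R I) \<in> U}"

definition even_odd_on ::
    "(real \<times> real) set \<Rightarrow> (real \<times> real \<Rightarrow> 'b) \<Rightarrow> (real \<times> real \<Rightarrow> 'b::uminus) \<Rightarrow> bool"
  where "even_odd_on V \<alpha> \<beta> \<longleftrightarrow>
    (\<forall>(u, v)\<in>V. \<alpha> (u, - v) = \<alpha> (u, v) \<and> \<beta> (u, - v) = - \<beta> (u, v))"

definition holomorphic_pair ::
    "(real \<times> real) set \<Rightarrow> (real \<times> real \<Rightarrow> 'b) \<Rightarrow> (real \<times> real \<Rightarrow> 'b::real_normed_vector) \<Rightarrow> bool"
  where "holomorphic_pair V \<alpha> \<beta> \<longleftrightarrow>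
    even_odd_on V \<alpha> \<beta> \<and> \<alpha> differentiable_on V \<and> \<beta> differentiable_on V \<and>
    (\<forall>p\<in>V. partial_deriv (1, 0) \<alpha> p = partial_deriv (0, 1) \<beta> p \<and>
           partial_deriv (0, 1) \<alpha> p = - partial_deriv (1, 0) \<beta> p)"

definition left_slice_hyperholomorphic ::
    "'n::{finite,linorder} point set \<Rightarrow> ('n point \<Rightarrow> 'n clifford) \<Rightarrow> bool"
  where "left_slice_hyperholomorphic U f \<longleftrightarrow>
    (\<exists>\<alpha> \<beta>. holomorphic_pair (slice_domain U) \<alpha> \<beta> \<and>
      (\<forall>I\<in>unit_vectors. \<forall>(u, v)\<in>slice_domain U.
         f (u, v *\<^sub>R I) = \<alpha> (u, v) + vec_embed I * \<beta> (u, v)))"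

definition right_slice_hyperholomorphic ::
    "'n::{finite,linorder} point set \<Rightarrow> ('n point \<Rightarrow> 'n clifford) \<Rightarrow> bool"
  where "right_slice_hyperholomorphic U f \<longleftrightarrow>
    (\<exists>\<alpha> \<beta>. holomorphic_pair (slice_domain U) \<alpha> \<beta> \<and>
      (\<forall>I\<in>unit_vectors. \<forall>(u, v)\<in>slice_domain U.
         f (u, v *\<^sub>R I) = \<alpha> (u, v) + \<beta> (u, v) * vec_embed I))"

text \<open>
  At real points \<open>snd x / norm (snd x)\<close> is \<open>0\<close> by convention; this is harmless because the odd
  function \<open>B\<close> vanishes there.
\<close>

definition left_axial_form ::
    "'n::{finite,linorder} point set \<Rightarrow> ('n point \<Rightarrow> 'n clifford) \<Rightarrow> bool"
  where "left_axial_form U g \<longleftrightarrow>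
    (\<exists>A B. even_odd_on (slice_domain U) A B \<and>
      (\<forall>x\<in>U. g x = A (fst x, norm (snd x))
                 + vec_embed (snd x /\<^sub>R norm (snd x)) * B (fst x, norm (snd x))))"

definition right_axial_form ::
    "'n::{finite,linorder} point set \<Rightarrow> ('n point \<Rightarrow> 'n clifford) \<Rightarrow> bool"
  where "right_axial_form U g \<longleftrightarrow>
    (\<exists>A B. even_odd_on (slice_domain U) A B \<and>
      (\<forall>x\<in>U. g x = A (fst x, norm (snd x))
                 + B (fst x, norm (snd x)) * vec_embed (snd x /\<^sub>R norm (snd x))))"

definition left_axially_polyanalytic ::
    "nat \<Rightarrow> 'n::{finite,linorder} point set \<Rightarrow> ('n point \<Rightarrow> 'n clifford) \<Rightarrow> bool"
  where "left_axially_polyanalytic m U g \<longleftrightarrow>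
    C_class_on m g U \<and> (\<forall>x\<in>U. (D_left ^^ m) g x = 0) \<and> left_axial_form U g"

definition right_axially_polyanalytic ::
    "nat \<Rightarrow> 'n::{finite,linorder} point set \<Rightarrow> ('n point \<Rightarrow> 'n clifford) \<Rightarrow> bool"
  where "right_axially_polyanalytic m U g \<longleftrightarrow>
    C_class_on m g U \<and> (\<forall>x\<in>U. (D_right ^^ m) g x = 0) \<and> right_axial_form U g"

end

theory Submission
  imports Defs "HOL-Complex_Analysis.Cauchy_Integral_Formula" "HOL-Library.Function_Algebras"
begin

text \<open>
  Divide the odd component of \<open>f\<close> by \<open>v\<close>: then \<open>f(x\<^sub>0 + y) = a(x\<^sub>0, |y|) + y c(x\<^sub>0, |y|)\<close> with
  \<open>a\<close>, \<open>c\<close> even in \<open>v\<close> and, by Hadamard's lemma, smooth across the real axis. With \<open>P = \<partial>\<^sub>u\<close> and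
  \<open>Q = v\<^sup>-\<^sup>1\<partial>\<^sub>v\<close> the Cauchy--Riemann equations give \<open>D f = (1 - n) c\<close> and, after applying
  \<open>Q\<^sup>k\<close>, \<open>\<Delta> Q\<^sup>k c = (n - 2 k - 3) Q\<^sup>k\<^sup>+\<^sup>1 c\<close>. Since \<open>n = 2 h + 1\<close>, the factor for
  \<open>k = h - 1\<close> vanishes and \<open>\<Delta>\<^sup>h D f = 0\<close> (Fueter--Sce). As \<open>D\<close> and its conjugate commute with
  product \<open>\<Delta>\<close>, applying \<open>D\<^sup>h\<^sup>-\<^sup>l\<^sup>+\<^sup>1\<close> to the function in question yields \<open>\<Delta>\<^sup>h D f\<close>.
\<close>

section \<open>Partial derivatives and the classes \<open>C\<^sup>k\<close>\<close>

text \<open>Two obstacles shape the proof. The components of f are only assumed differentiable,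
  while the claim involves derivatives of order 2 h + 1. Each coordinate of \<alpha> and \<beta> is
  therefore read as the real and imaginary part of a complex function, and smoothness comes from
  complex analysis. The other obstacle is the real axis, where y / |y| and 1 / v are undefined.
  Writing the vector part as y c with c even, not as a unit vector times an odd function, removes
  the direction; and Q maps even smooth functions to even smooth functions, so the operator
  identities hold at real points too. The order h - l + 1 is a matter of counting: D times its
  conjugate is the Laplacian, so h - l of the factors D absorb the h - l conjugates and exactly one
  D is left over for f. All of this uses only that P commutes with Q and M and that Q M - M Q = 2.
  It is carried out for abstract operators and transported to functions afterwards.\<close>

abbreviation has_partial_deriv ::
    "'a::real_normed_vector \<Rightarrow> ('a \<Rightarrow> 'b::real_normed_vector) \<Rightarrow> 'a \<Rightarrow> 'b \<Rightarrow> bool"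
  where "has_partial_deriv b f x d \<equiv> ((\<lambda>t. f (x + t *\<^sub>R b)) has_vector_derivative d) (at 0)"

lemma partial_deriv_eqI: "has_partial_deriv b f x d \<Longrightarrow> partial_deriv b f x = d"
  by (simp add: partial_deriv_def vector_derivative_at)

lemma has_partial_deriv_partial_deriv:
  "(\<lambda>t. f (x + t *\<^sub>R b)) differentiable (at 0) \<Longrightarrow> has_partial_deriv b f x (partial_deriv b f x)"
  by (simp add: partial_deriv_def vector_derivative_works)

lemma has_partial_deriv_differentiable:
  "has_partial_deriv b f x d \<Longrightarrow> (\<lambda>t. f (x + t *\<^sub>R b)) differentiable (at 0)"
  by (metis differentiableI_vector)

lemma has_derivative_imp_has_partial_deriv:
  assumes "(f has_derivative f') (at x)"
  shows "has_partial_deriv b f x (f' b)"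
proof -
  interpret bounded_linear f' by (rule has_derivative_bounded_linear [OF assms])
  have "((\<lambda>t. f (x + t *\<^sub>R b)) has_derivative (\<lambda>t. f' (t *\<^sub>R b))) (at 0)"
    by (rule has_derivative_compose[of "\<lambda>t. x + t *\<^sub>R b" "\<lambda>t. t *\<^sub>R b" 0 UNIV f f'])
       (auto intro!: derivative_eq_intros simp: assms)
  thus ?thesis by (simp add: has_vector_derivative_def scaleR)
qed

text \<open>\<open>partial_deriv\<close> is a derivative at parameter 0. The chain rule along a
  rescaled line needs it at every parameter \<open>s\<close>; translating the parameter supplies
  it.\<close>

lemma partial_deriv_line:
  assumes "(\<lambda>t. f (x + s *\<^sub>R b + t *\<^sub>R b)) differentiable (at 0)"
  shows "((\<lambda>t. f (x + t *\<^sub>R b)) has_vector_derivative partial_deriv b f (x + s *\<^sub>R b)) (at s)"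
proof -
  have "((\<lambda>t. f (x + s *\<^sub>R b + t *\<^sub>R b)) has_vector_derivative partial_deriv b f (x + s *\<^sub>R b)) (at (s - s))"
    using has_partial_deriv_partial_deriv[OF assms] by simp
  moreover have "((\<lambda>t. t - s) has_vector_derivative 1) (at s)"
    by (auto intro!: derivative_eq_intros)
  ultimately have "((\<lambda>t. f (x + s *\<^sub>R b + t *\<^sub>R b)) \<circ> (\<lambda>t. t - s) has_vector_derivative
      1 *\<^sub>R partial_deriv b f (x + s *\<^sub>R b)) (at s)"
    by (intro vector_diff_chain_at) auto
  thus ?thesis by (simp add: o_def algebra_simps)
qed

lemma has_partial_deriv_transform:
  assumes "has_partial_deriv b f x d" "open U" "x \<in> U" "\<And>y. y \<in> U \<Longrightarrow> f y = g y"
  shows "has_partial_deriv b g x d"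
proof (rule has_vector_derivative_transform_within_open[OF assms(1)])
  show "open ((\<lambda>t. x + t *\<^sub>R b) -` U)"
    by (intro open_vimage assms continuous_intros)
qed (use assms in auto)

lemma differentiable_line_cong:
  fixes f g :: "'a::real_normed_vector \<Rightarrow> 'b::real_normed_vector"
  assumes "open U" "x \<in> U" "\<And>y. y \<in> U \<Longrightarrow> f y = g y"
  shows "(\<lambda>t. f (x + t *\<^sub>R b)) differentiable (at 0) \<longleftrightarrow> (\<lambda>t. g (x + t *\<^sub>R b)) differentiable (at 0)"
  using has_partial_deriv_transform[where f = f and g = g and b = b] has_partial_deriv_transform[where f = g and g = f and b = b]
  by (metis assms has_partial_deriv_partial_deriv has_partial_deriv_differentiable)

lemma partial_deriv_cong:
  assumes "open U" "x \<in> U" "\<And>y. y \<in> U \<Longrightarrow> f y = g y"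
  shows "partial_deriv b f x = partial_deriv b g x"
proof -
  \<comment> \<open>No differentiability is at hand: \<open>vector_derivative\<close> chooses among
    all derivatives, and \<open>f\<close> and \<open>g\<close> have the same ones, possibly
    none.\<close>
  have "has_partial_deriv b f x d \<longleftrightarrow> has_partial_deriv b g x d" for d
    using has_partial_deriv_transform[where f = f and g = g and b = b] has_partial_deriv_transform[where f = g and g = f and b = b]
      assms by auto
  thus ?thesis by (simp add: partial_deriv_def vector_derivative_def)
qed

lemma C_class_on_imp_continuous_on: "C_class_on k f U \<Longrightarrow> continuous_on U f"
  by (cases k) auto

lemma C_class_on_cong:
  assumes "open U" "\<And>x. x \<in> U \<Longrightarrow> f x = g x"
  shows "C_class_on k f U \<longleftrightarrow> C_class_on k g U"
  using assms(2)
proof (induction k arbitrary: f g)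
  case 0
  thus ?case by (simp cong: continuous_on_cong)
next
  case (Suc k)
  have "C_class_on k (partial_deriv b f) U = C_class_on k (partial_deriv b g) U" for b
    by (rule Suc.IH) (use partial_deriv_cong[OF assms(1) _ Suc.prems] in auto)
  moreover have "continuous_on U f = continuous_on U g"
    using Suc.prems by (simp cong: continuous_on_cong)
  moreover have "(\<lambda>t. f (x + t *\<^sub>R b)) differentiable (at 0) \<longleftrightarrow>
      (\<lambda>t. g (x + t *\<^sub>R b)) differentiable (at 0)" if "x \<in> U" for x b
    by (rule differentiable_line_cong[OF assms(1) that Suc.prems])
  ultimately show ?case by auto
qed

lemma C_class_on_transform:
  "C_class_on k f U \<Longrightarrow> open U \<Longrightarrow> (\<And>x. x \<in> U \<Longrightarrow> f x = g x) \<Longrightarrow> C_class_on k g U"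
  using C_class_on_cong by blast

text \<open>Inductions on the order go through this rule: an explicit candidate for each partial
  derivative replaces \<open>partial_deriv\<close>, with which it need only agree on
  \<open>U\<close>.\<close>

lemma C_class_on_SucI:
  assumes "open U" "continuous_on U f"
    "\<And>b x. b \<in> Basis \<Longrightarrow> x \<in> U \<Longrightarrow> has_partial_deriv b f x (f' b x)"
    "\<And>b. b \<in> Basis \<Longrightarrow> C_class_on k (f' b) U"
  shows "C_class_on (Suc k) f U"
proof -
  have "C_class_on k (partial_deriv b f) U" if "b \<in> Basis" for b
    using C_class_on_transform[OF assms(4)[OF that] assms(1)] partial_deriv_eqI[OF assms(3)[OF that]]
    by metis
  thus ?thesis using assms has_partial_deriv_differentiable by fastforce
qed

lemma C_class_on_Suc_has_partial_deriv:
  "C_class_on (Suc k) f U \<Longrightarrow> b \<in> Basis \<Longrightarrow> x \<in> U \<Longrightarrow>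
     has_partial_deriv b f x (partial_deriv b f x)"
  by (auto intro: has_partial_deriv_partial_deriv)

lemma C_class_on_SucD: "C_class_on (Suc k) f U \<Longrightarrow> C_class_on k f U"
  by (induction k arbitrary: f) auto

lemma C_class_on_subset: "C_class_on k f U \<Longrightarrow> W \<subseteq> U \<Longrightarrow> C_class_on k f W"
  by (induction k arbitrary: f) (auto intro: continuous_on_subset)

text \<open>Serves the quotient by v, which is described by different formulas near the axis and
  away from it.\<close>

lemma C_class_on_local:
  assumes "\<And>x. x \<in> U \<Longrightarrow> \<exists>W. open W \<and> x \<in> W \<and> C_class_on k f W"
  shows "C_class_on k f U"
  using assms
proof (induction k arbitrary: f)
  case 0
  thus ?case
    by (intro C_class_on.simps(1)[THEN iffD2] continuous_at_imp_continuous_on ballI)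
      (metis C_class_on.simps(1) continuous_on_eq_continuous_at)
next
  case (Suc k)
  have "continuous_on U f"
    using Suc.prems
    by (intro continuous_at_imp_continuous_on)
       (metis continuous_on_eq_continuous_at C_class_on_imp_continuous_on)
  moreover have "C_class_on k (partial_deriv b f) U" if "b \<in> Basis" for b
  proof (rule Suc.IH)
    fix x assume "x \<in> U"
    then obtain W where "open W" "x \<in> W" "C_class_on (Suc k) f W" using Suc.prems by blast
    thus "\<exists>W. open W \<and> x \<in> W \<and> C_class_on k (partial_deriv b f) W" using that by auto
  qed
  ultimately show ?case using Suc.prems by fastforce
qed

section \<open>Closure properties of the classes C^k\<close>

lemma C_class_on_const: "open U \<Longrightarrow> C_class_on k (\<lambda>_. c) U"
proof (induction k arbitrary: c)
  case (Suc k)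
  show ?case by (rule C_class_on_SucI[where f' = "\<lambda>_ _. 0"]) (use Suc in auto)
qed auto

lemma C_class_on_add:
  "open U \<Longrightarrow> C_class_on k f U \<Longrightarrow> C_class_on k g U \<Longrightarrow> C_class_on k (\<lambda>x. f x + g x) U"
proof (induction k arbitrary: f g)
  case (Suc k)
  show ?case
  proof (rule C_class_on_SucI[OF Suc.prems(1)])
    fix b x assume bx: "b \<in> (Basis :: 'a set)" "x \<in> U"
    show "has_partial_deriv b (\<lambda>x. f x + g x) x (partial_deriv b f x + partial_deriv b g x)"
      by (rule has_vector_derivative_add;
          rule C_class_on_Suc_has_partial_deriv[OF _ bx]; rule Suc.prems)
  qed (use Suc in \<open>auto intro!: continuous_on_add\<close>)
qed (auto intro: continuous_on_add)

lemma C_class_on_bounded_linear: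
  fixes f :: "'a::euclidean_space \<Rightarrow> 'b::real_normed_vector"
  assumes "bounded_linear J"
  shows "open U \<Longrightarrow> C_class_on k f U \<Longrightarrow> C_class_on k (\<lambda>x. J (f x)) U"
proof (induction k arbitrary: f)
  case 0
  thus ?case using bounded_linear.continuous_on[OF assms] by auto
next
  case (Suc k)
  show ?case
  proof (rule C_class_on_SucI[OF Suc.prems(1)])
    fix b x assume bx: "b \<in> (Basis :: 'a set)" "x \<in> U"
    show "has_partial_deriv b (\<lambda>x. J (f x)) x (J (partial_deriv b f x))"
      by (rule bounded_linear.has_vector_derivative[OF assms],
          rule C_class_on_Suc_has_partial_deriv[OF _ bx], rule Suc.prems)
  qed (use Suc bounded_linear.continuous_on[OF assms] in auto)
qed

lemma C_class_on_scaleR: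
  fixes a :: "'a::euclidean_space \<Rightarrow> real"
  shows "open U \<Longrightarrow> C_class_on k a U \<Longrightarrow> C_class_on k f U \<Longrightarrow> C_class_on k (\<lambda>x. a x *\<^sub>R f x) U"
proof (induction k arbitrary: a f)
  case (Suc k)
  show ?case
  proof (rule C_class_on_SucI[OF Suc.prems(1)])
    fix b x assume bx: "b \<in> (Basis :: 'a set)" "x \<in> U"
    from C_class_on_Suc_has_partial_deriv[OF Suc.prems(2) bx]
      C_class_on_Suc_has_partial_deriv[OF Suc.prems(3) bx]
    show "has_partial_deriv b (\<lambda>x. a x *\<^sub>R f x) x
        (a x *\<^sub>R partial_deriv b f x + partial_deriv b a x *\<^sub>R f x)"
      using has_vector_derivative_scaleR[of "\<lambda>t. a (x + t *\<^sub>R b)" "partial_deriv b a x" 0 UNIV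
          "\<lambda>t. f (x + t *\<^sub>R b)" "partial_deriv b f x"]
      by (simp add: has_real_derivative_iff_has_vector_derivative)
  next
    fix b assume b: "b \<in> (Basis :: 'a set)"
    show "C_class_on k (\<lambda>x. a x *\<^sub>R partial_deriv b f x + partial_deriv b a x *\<^sub>R f x) U"
      using b Suc.prems C_class_on_SucD[OF Suc.prems(2)] C_class_on_SucD[OF Suc.prems(3)]
      by (intro C_class_on_add Suc.IH Suc.prems) auto
  qed (use Suc in \<open>auto intro!: continuous_on_scaleR\<close>)
qed (auto intro: continuous_on_scaleR)

lemma C_class_on_linear_functional:
  assumes "bounded_linear a" "open U"
  shows "C_class_on k a U"
proof (cases k)
  case 0
  thus ?thesis using bounded_linear.continuous_on[OF assms(1) continuous_on_id] by simp
next
  case (Suc m)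
  interpret bounded_linear a by fact
  have "has_partial_deriv b a x (a b)" for b x
    using has_derivative_imp_has_partial_deriv[OF bounded_linear_imp_has_derivative[OF assms(1)]] .
  thus ?thesis unfolding Suc
    by (intro C_class_on_SucI[where f' = "\<lambda>b _. a b"])
      (auto simp: assms continuous_on C_class_on_const continuous_on_id)
qed

lemma C_class_on_inverse:
  fixes a :: "'a::euclidean_space \<Rightarrow> real"
  shows "open U \<Longrightarrow> C_class_on k a U \<Longrightarrow> (\<And>x. x \<in> U \<Longrightarrow> a x \<noteq> 0) \<Longrightarrow> C_class_on k (\<lambda>x. inverse (a x)) U"
proof (induction k)
  case (Suc k)
  show ?case
  proof (rule C_class_on_SucI[OF Suc.prems(1)])
    fix b x assume bx: "b \<in> (Basis :: 'a set)" "x \<in> U"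
    from C_class_on_Suc_has_partial_deriv[OF Suc.prems(2) bx]
    \<comment> \<open>The derivative -a' / a^2 is written with two factors
      \<open>inverse (a x)\<close>, so that the induction hypothesis and closure under products
      cover it.\<close>
    show "has_partial_deriv b (\<lambda>x. inverse (a x)) x
        ((inverse (a x) *\<^sub>R inverse (a x)) *\<^sub>R ((-1) *\<^sub>R partial_deriv b a x))"
      unfolding has_real_derivative_iff_has_vector_derivative [symmetric]
      using DERIV_inverse_fun[of "\<lambda>t. a (x + t *\<^sub>R b)" "partial_deriv b a x" 0 UNIV] Suc.prems(3)[OF bx(2)]
      by (simp add: mult_ac)
  next
    fix b assume b: "b \<in> (Basis :: 'a set)"
    have *: "C_class_on k (\<lambda>x. inverse (a x)) U"
      using Suc C_class_on_SucD[OF Suc.prems(2)] by blast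
    show "C_class_on k (\<lambda>x. (inverse (a x) *\<^sub>R inverse (a x)) *\<^sub>R ((-1) *\<^sub>R partial_deriv b a x)) U"
      using b Suc.prems by (intro C_class_on_scaleR * C_class_on_const) auto
  qed (use Suc in \<open>auto intro!: continuous_on_inverse\<close>)
qed (auto intro: continuous_on_inverse)

section \<open>Smooth functions of two real variables\<close>

definition smooth_on :: "'a::euclidean_space set \<Rightarrow> ('a \<Rightarrow> 'b::real_normed_vector) \<Rightarrow> bool"
  where "smooth_on U f \<longleftrightarrow> (\<forall>k. C_class_on k f U)"

lemma smooth_on_partial_deriv: "smooth_on U f \<Longrightarrow> b \<in> Basis \<Longrightarrow> smooth_on U (partial_deriv b f)"
  unfolding smooth_on_def using C_class_on.simps(2) by blast

lemma smooth_on_has_partial_deriv: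
  "smooth_on U f \<Longrightarrow> b \<in> Basis \<Longrightarrow> x \<in> U \<Longrightarrow> has_partial_deriv b f x (partial_deriv b f x)"
  unfolding smooth_on_def using C_class_on_Suc_has_partial_deriv by blast

lemma Basis_real2: "(Basis :: (real \<times> real) set) = {(1, 0), (0, 1)}"
  by (auto simp: Basis_prod_def)

lemma vector_derivative_shift_0:
  "((\<lambda>t. f (v + t :: real)) has_vector_derivative d) (at 0) \<longleftrightarrow> (f has_vector_derivative d) (at v)"
proof
  assume "((\<lambda>t. f (v + t)) has_vector_derivative d) (at 0)"
  hence "((\<lambda>t. f (v + t)) has_vector_derivative d) (at (v - v))" by simp
  moreover have "((\<lambda>t. t - v) has_vector_derivative 1) (at v)"
    by (auto intro!: derivative_eq_intros)
  ultimately show "(f has_vector_derivative d) (at v)"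
    using vector_diff_chain_at[of "\<lambda>t. t - v" 1 v "\<lambda>t. f (v + t)" d] by (simp add: o_def)
next
  assume "(f has_vector_derivative d) (at v)"
  hence "(f has_vector_derivative d) (at (v + 0))" by simp
  moreover have "((\<lambda>t. v + t) has_vector_derivative 1) (at 0)"
    by (auto intro!: derivative_eq_intros)
  ultimately show "((\<lambda>t. f (v + t)) has_vector_derivative d) (at 0)"
    using vector_diff_chain_at[of "\<lambda>t. v + t" 1 0 f d] by (simp add: o_def)
qed

lemma has_partial_deriv_real2:
  "has_partial_deriv (1, 0) f (u, v) d \<longleftrightarrow> ((\<lambda>u. f (u, v)) has_vector_derivative d) (at u)"
  "has_partial_deriv (0, 1) f (u, v) d \<longleftrightarrow> ((\<lambda>v. f (u, v)) has_vector_derivative d) (at v)"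
  using vector_derivative_shift_0[of "\<lambda>u. f (u, v)" u d]
    vector_derivative_shift_0[of "\<lambda>v. f (u, v)" v d]
  by simp_all

lemma C_class_on_real2_derivs:
  assumes "C_class_on (Suc k) f V" "(u, v) \<in> V"
  shows "((\<lambda>u. f (u, v)) has_vector_derivative partial_deriv (1, 0) f (u, v)) (at u)"
    and "((\<lambda>v. f (u, v)) has_vector_derivative partial_deriv (0, 1) f (u, v)) (at v)"
  unfolding has_partial_deriv_real2 [symmetric]
  by (rule C_class_on_Suc_has_partial_deriv[OF assms(1) _ assms(2)]; simp add: Basis_real2)+

lemma open_real2_square:
  assumes "open V" "(a, b) \<in> V"
  obtains r :: real where "r > 0" "ball a r \<times> ball b r \<subseteq> (V :: (real \<times> real) set)"
proof -
  obtain A B where "open A" "open B" "(a, b) \<in> A \<times> B" "A \<times> B \<subseteq> V"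
    by (rule open_prod_elim[OF assms])
  hence AB: "open A" "open B" "a \<in> A" "b \<in> B" "A \<times> B \<subseteq> V" by simp_all
  obtain r where r: "r > 0" "ball a r \<subseteq> A"
    using AB open_contains_ball by blast
  obtain s where s: "s > 0" "ball b s \<subseteq> B"
    using AB open_contains_ball by blast
  have "ball a (min r s) \<subseteq> A" "ball b (min r s) \<subseteq> B"
    using r s by (force simp: ball_def)+
  hence "ball a (min r s) \<times> ball b (min r s) \<subseteq> V" using AB(5) by blast
  moreover have "min r s > 0" using r s by simp
  ultimately show ?thesis by (rule that [rotated])
qed

text \<open>Schwarz's theorem, by differentiating the fundamental theorem of calculus under the integral.\<close>

lemma partial_deriv_commute:
  fixes f :: "real \<times> real \<Rightarrow> 'c::euclidean_space"
  assumes "open V" "p \<in> V" and f: "C_class_on (Suc (Suc 0)) f V"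
  shows "partial_deriv (1, 0) (partial_deriv (0, 1) f) p = partial_deriv (0, 1) (partial_deriv (1, 0) f) p"
proof -
  obtain a b where p: "p = (a, b)" by (cases p)
  obtain r where r: "r > 0" "ball a r \<times> ball b r \<subseteq> V"
    using open_real2_square assms p by metis
  let ?fu = "partial_deriv (1, 0) f" and ?fv = "partial_deriv (0, 1) f"
  let ?g = "partial_deriv (1, 0) ?fv"
  have C: "C_class_on (Suc 0) ?fu V" "C_class_on (Suc 0) ?fv V" "continuous_on V ?g"
    using f by (simp_all add: Basis_real2)
  define c where "c = b - r / 2"
  define d where "d = b + r / 2"
  have cd: "c < b" "b < d" using r by (auto simp: c_def d_def)
  have in_V: "(u, y) \<in> V" if "u \<in> ball a r" "y \<in> {c..d}" for u y
    using r that by (auto simp: c_def d_def subset_iff dist_real_def)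
  have cont: "continuous_on {c..d} (\<lambda>y. h (u, y))" if "continuous_on V h" "u \<in> ball a r"
    for u and h :: "real \<times> real \<Rightarrow> 'c"
    by (rule continuous_on_compose2[OF that(1)]) (use that in_V in \<open>auto intro!: continuous_intros\<close>)
  have eq: "f (u, y) = f (u, c) + integral {c..y} (\<lambda>t. ?fv (u, t))"
    if "u \<in> ball a r" "y \<in> {c..d}" for u y
  proof -
    have "((\<lambda>t. ?fv (u, t)) has_integral (f (u, y) - f (u, c))) {c..y}"
    proof (rule fundamental_theorem_of_calculus)
      fix t assume "t \<in> {c..y}"
      hence "(u, t) \<in> V" using that by (intro in_V) auto
      from C_class_on_real2_derivs(2)[OF f this]
      show "((\<lambda>t. f (u, t)) has_vector_derivative ?fv (u, t)) (at t within {c..y})"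
        by (rule has_vector_derivative_at_within)
    qed (use that in simp)
    thus ?thesis by (simp add: integral_unique)
  qed
  have eq2: "?fu (a, y) = ?fu (a, c) + integral {c..y} (\<lambda>t. ?g (a, t))" if y: "y \<in> {c..d}" for y
  proof -
    have yy: "(u, t) \<in> V" if "u \<in> ball a r" "t \<in> {c..y}" for u t using that y in_V by auto
    have "((\<lambda>u. integral (cbox c y) (\<lambda>t. ?fv (u, t))) has_vector_derivative
            integral (cbox c y) (\<lambda>t. ?g (a, t))) (at a within ball a r)"
    proof (rule leibniz_rule_vector_derivative)
      show "((\<lambda>u. ?fv (u, t)) has_vector_derivative ?g (u, t)) (at u within ball a r)"
        if "u \<in> ball a r" "t \<in> cbox c y" for u t
        by (rule has_vector_derivative_at_within, rule C_class_on_real2_derivs(1)[OF C(2)], rule yy)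
          (use that in auto)
      show "(\<lambda>t. ?fv (u, t)) integrable_on cbox c y" if "u \<in> ball a r" for u
      proof -
        have "continuous_on {c..y} (\<lambda>t. ?fv (u, t))"
          by (rule continuous_on_subset[OF cont[OF C_class_on_imp_continuous_on[OF C(2)] that]])
            (use y in auto)
        thus ?thesis by (simp add: integrable_continuous_real)
      qed
      show "continuous_on (ball a r \<times> cbox c y) (\<lambda>(u, t). ?g (u, t))"
      proof -
        have "ball a r \<times> cbox c y \<subseteq> V" using yy by (auto simp del: mem_ball)
        from continuous_on_subset[OF C(3) this] show ?thesis by (simp add: case_prod_eta)
      qed
    qed (use r in auto)
    hence "((\<lambda>u. integral {c..y} (\<lambda>t. ?fv (u, t))) has_vector_derivative
            integral {c..y} (\<lambda>t. ?g (a, t))) (at a)"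
      using r by (simp add: at_within_open[of a "ball a r"])
    moreover have "((\<lambda>u. f (u, c)) has_vector_derivative ?fu (a, c)) (at a)"
      by (rule C_class_on_real2_derivs[OF f]) (use in_V cd r in auto)
    ultimately have "((\<lambda>u. f (u, c) + integral {c..y} (\<lambda>t. ?fv (u, t))) has_vector_derivative
            ?fu (a, c) + integral {c..y} (\<lambda>t. ?g (a, t))) (at a)"
      by (intro has_vector_derivative_add)
    hence "((\<lambda>u. f (u, y)) has_vector_derivative
            ?fu (a, c) + integral {c..y} (\<lambda>t. ?g (a, t))) (at a)"
      by (rule has_vector_derivative_transform_within_open[where S = "ball a r"])
        (use r in \<open>auto intro: eq[OF _ y, symmetric]\<close>)
    moreover have "((\<lambda>u. f (u, y)) has_vector_derivative ?fu (a, y)) (at a)"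
      by (rule C_class_on_real2_derivs[OF f]) (use in_V y r in auto)
    ultimately show ?thesis by (rule vector_derivative_unique_at [rotated])
  qed
  \<comment> \<open>By \<open>eq2\<close>, \<open>?fu (a, y)\<close> is a constant plus an integral
    with continuous integrand. Its derivative at the interior point \<open>b\<close> is the
    integrand, that is, the mixed derivative in the other order.\<close>
  have "((\<lambda>y. integral {c..y} (\<lambda>t. ?g (a, t))) has_vector_derivative ?g (a, b)) (at b within {c..d})"
  proof (rule integral_has_vector_derivative)
    show "continuous_on {c..d} (\<lambda>t. ?g (a, t))" by (rule cont[OF C(3)]) (use r in simp)
  qed (use cd in simp)
  hence "((\<lambda>y. integral {c..y} (\<lambda>t. ?g (a, t))) has_vector_derivative ?g (a, b)) (at b)"
    by (simp only: at_within_Icc_at[OF cd])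
  hence "((\<lambda>y. ?fu (a, c) + integral {c..y} (\<lambda>t. ?g (a, t))) has_vector_derivative 0 + ?g (a, b)) (at b)"
    by (intro has_vector_derivative_add) auto
  hence "((\<lambda>y. ?fu (a, y)) has_vector_derivative 0 + ?g (a, b)) (at b)"
    by (rule has_vector_derivative_transform_within_open[where S = "{c<..<d}"]) (use cd in \<open>auto intro: eq2[symmetric]\<close>)
  moreover have "((\<lambda>y. ?fu (a, y)) has_vector_derivative partial_deriv (0, 1) ?fu (a, b)) (at b)"
    by (rule C_class_on_real2_derivs[OF C(1)]) (use assms p in auto)
  ultimately have "0 + ?g (a, b) = partial_deriv (0, 1) ?fu (a, b)"
    by (rule vector_derivative_unique_at)
  thus ?thesis using p by simp
qed

text \<open>Differentiation under the integral sign. Each derivative in v brings out a factor t by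
  the chain rule, so the induction needs every weight \<open>t ^ j\<close>, although the quotient by
  v is only the case \<open>j = 0\<close>.\<close>

lemma C_class_on_average:
  fixes f :: "real \<times> real \<Rightarrow> 'c::euclidean_space"
  assumes "open W" and W: "\<And>u v t. (u, v) \<in> W \<Longrightarrow> t \<in> {0..1} \<Longrightarrow> (u, t * v) \<in> W"
  shows "C_class_on k f W \<Longrightarrow>
    C_class_on k (\<lambda>p. integral {0..1} (\<lambda>t. t ^ j *\<^sub>R f (fst p, t * snd p))) W"
proof (induction k arbitrary: f j)
  case 0
  have "continuous_on (W \<times> cbox 0 1) (\<lambda>(p, t). t ^ j *\<^sub>R f (fst p, t * snd p))"
    unfolding case_prod_unfold
    by (intro continuous_intros continuous_on_compose2[OF 0[unfolded C_class_on.simps]])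
      (use W in auto)
  from integral_continuous_on_param[OF this] show ?case by simp
next
  case (Suc k)
  \<comment> \<open>The exponent of t that a derivative in direction \<open>b\<close> brings out: 0
    for u and 1 for v.\<close>
  define e where "e = (\<lambda>b :: real \<times> real. if b = (1, 0) then 0 else 1 :: nat)"
  have scale: "(fst (p + s *\<^sub>R b), t * snd (p + s *\<^sub>R b)) = (fst p, t * snd p) + (s * t ^ e b) *\<^sub>R b"
    if "b \<in> Basis" for p b :: "real \<times> real" and s t :: real
    using that by (auto simp: Basis_real2 e_def algebra_simps)
  show ?case
  proof (rule C_class_on_SucI[OF assms(1)])
    have "continuous_on (W \<times> cbox 0 1) (\<lambda>(p, t). t ^ j *\<^sub>R f (fst p, t * snd p))"
      unfolding case_prod_unfold
      by (intro continuous_intros continuous_on_compose2[OF C_class_on_imp_continuous_on[OF Suc.prems]])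
        (use W in auto)
    from integral_continuous_on_param[OF this]
    show "continuous_on W (\<lambda>p. integral {0..1} (\<lambda>t. t ^ j *\<^sub>R f (fst p, t * snd p)))"
      by simp
  next
    fix b p assume b: "b \<in> (Basis :: (real \<times> real) set)" and p: "p \<in> W"
    let ?f' = "partial_deriv b f"
    have "open ((\<lambda>s. p + s *\<^sub>R b) -` W)"
      by (intro open_vimage assms continuous_intros)
    moreover have "0 \<in> (\<lambda>s. p + s *\<^sub>R b) -` W" using p by simp
    ultimately obtain r where r: "r > 0" "ball 0 r \<subseteq> (\<lambda>s. p + s *\<^sub>R b) -` W"
      using open_contains_ball by metis
    have in_W: "(fst p, t * snd p) + (s * t ^ e b) *\<^sub>R b \<in> W" if "s \<in> ball 0 r" "t \<in> {0..1}" for s t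
    proof -
      have "p + s *\<^sub>R b \<in> W" using r that(1) by blast
      thus ?thesis
        using W[of "fst (p + s *\<^sub>R b)" "snd (p + s *\<^sub>R b)" t] that(2) unfolding scale[OF b, symmetric]
        by (simp only: prod.collapse)
    qed
    have c: "continuous_on (ball 0 r \<times> {0..1}) (\<lambda>(s, t). t ^ i *\<^sub>R h ((fst p, t * snd p) + (s * t ^ e b) *\<^sub>R b))"
      if "continuous_on W h" for h :: "real \<times> real \<Rightarrow> 'c" and i
      unfolding case_prod_unfold
      by (intro continuous_intros continuous_on_compose2[OF that]) (use in_W in auto)
    have "((\<lambda>s. integral (cbox 0 1) (\<lambda>t. t ^ j *\<^sub>R f ((fst p, t * snd p) + (s * t ^ e b) *\<^sub>R b)))
        has_vector_derivative
        integral (cbox 0 1) (\<lambda>t. t ^ (j + e b) *\<^sub>R ?f' ((fst p, t * snd p) + (0 * t ^ e b) *\<^sub>R b)))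
        (at 0 within ball 0 r)"
    proof (rule leibniz_rule_vector_derivative[where
          fx = "\<lambda>s t. t ^ (j + e b) *\<^sub>R ?f' ((fst p, t * snd p) + (s * t ^ e b) *\<^sub>R b)"])
      fix s t :: real assume st: "s \<in> ball 0 r" "t \<in> cbox 0 1"
      have 1: "((\<lambda>s. f ((fst p, t * snd p) + s *\<^sub>R b)) has_vector_derivative
          ?f' ((fst p, t * snd p) + (s * t ^ e b) *\<^sub>R b)) (at (s * t ^ e b))"
        by (rule partial_deriv_line) (use in_W[of s t] st b Suc.prems in auto)
      have 2: "((\<lambda>s. s * t ^ e b) has_vector_derivative t ^ e b) (at s)"
        by (auto intro!: derivative_eq_intros simp: has_real_derivative_iff_has_vector_derivative[symmetric])
      have "((\<lambda>s. f ((fst p, t * snd p) + (s * t ^ e b) *\<^sub>R b)) has_vector_derivative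
          t ^ e b *\<^sub>R ?f' ((fst p, t * snd p) + (s * t ^ e b) *\<^sub>R b)) (at s)"
        using vector_diff_chain_at[OF 2, OF 1] by (simp only: o_def)
      from has_vector_derivative_at_within[OF
          bounded_linear.has_vector_derivative[OF bounded_linear_scaleR_right[of "t ^ j"] this]]
      show "((\<lambda>s. t ^ j *\<^sub>R f ((fst p, t * snd p) + (s * t ^ e b) *\<^sub>R b)) has_vector_derivative
          t ^ (j + e b) *\<^sub>R ?f' ((fst p, t * snd p) + (s * t ^ e b) *\<^sub>R b)) (at s within ball 0 r)"
        by (simp add: power_add)
    next
      fix s assume s: "s \<in> ball (0::real) r"
      have "continuous_on {0..1} (\<lambda>t. t ^ j *\<^sub>R f ((fst p, t * snd p) + (s * t ^ e b) *\<^sub>R b))"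
        by (intro continuous_intros continuous_on_compose2[OF C_class_on_imp_continuous_on[OF Suc.prems]])
          (use in_W[OF s] in auto)
      thus "(\<lambda>t. t ^ j *\<^sub>R f ((fst p, t * snd p) + (s * t ^ e b) *\<^sub>R b)) integrable_on cbox 0 1"
        by (simp add: integrable_continuous_real)
    next
      have "continuous_on W ?f'" using Suc.prems b C_class_on_imp_continuous_on by auto
      from c[OF this] show "continuous_on (ball 0 r \<times> cbox 0 1)
         (\<lambda>(s, t). t ^ (j + e b) *\<^sub>R ?f' ((fst p, t * snd p) + (s * t ^ e b) *\<^sub>R b))"
        by simp
    qed (use r in auto)
    hence "((\<lambda>s. integral {0..1} (\<lambda>t. t ^ j *\<^sub>R f ((fst p, t * snd p) + (s * t ^ e b) *\<^sub>R b)))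
        has_vector_derivative integral {0..1} (\<lambda>t. t ^ (j + e b) *\<^sub>R ?f' (fst p, t * snd p))) (at 0)"
      using r by (simp add: at_within_open[of 0 "ball 0 r"] flip: zero_prod_def)
    thus "has_partial_deriv b (\<lambda>p. integral {0..1} (\<lambda>t. t ^ j *\<^sub>R f (fst p, t * snd p))) p
        (integral {0..1} (\<lambda>t. t ^ (j + e b) *\<^sub>R ?f' (fst p, t * snd p)))"
      by (simp only: scale[OF b])
  next
    fix b assume b: "b \<in> (Basis :: (real \<times> real) set)"
    show "C_class_on k (\<lambda>p. integral {0..1} (\<lambda>t. t ^ (j + e b) *\<^sub>R partial_deriv b f (fst p, t * snd p))) W"
      using b Suc.prems by (intro Suc.IH) auto
  qed
qed

definition quot_v :: "(real \<times> real \<Rightarrow> 'c::real_normed_vector) \<Rightarrow> real \<times> real \<Rightarrow> 'c"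
  where "quot_v f p = (if snd p = 0 then partial_deriv (0, 1) f p else f p /\<^sub>R snd p)"

text \<open>Hadamard's lemma: near the axis the quotient is the average of \<open>\<partial>\<^sub>v f\<close> over \<open>[0, v]\<close>.\<close>

lemma smooth_on_quot_v:
  fixes f :: "real \<times> real \<Rightarrow> 'c::euclidean_space"
  assumes "open V" "smooth_on V f" and zero: "\<And>u. (u, 0) \<in> V \<Longrightarrow> f (u, 0) = 0"
  shows "smooth_on V (quot_v f)"
  unfolding smooth_on_def
proof (intro allI C_class_on_local)
  fix k p assume p: "p \<in> V"
  obtain a b where ab: "p = (a, b)" by (cases p)
  have f: "C_class_on m f V" for m using assms by (simp add: smooth_on_def)
  show "\<exists>W. open W \<and> p \<in> W \<and> C_class_on k (quot_v f) W"
  proof (cases "b = 0")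
    case False
    have "open (V \<inter> snd -` (- {0}))"
      by (intro open_Int assms open_vimage continuous_intros)
    moreover have "C_class_on k (\<lambda>p. inverse (snd p) *\<^sub>R f p) (V \<inter> snd -` (- {0}))"
      using calculation
      by (intro C_class_on_scaleR C_class_on_inverse C_class_on_linear_functional
            bounded_linear_snd C_class_on_subset[OF f]) auto
    hence "C_class_on k (quot_v f) (V \<inter> snd -` (- {0}))"
      using calculation by (rule C_class_on_transform) (auto simp: quot_v_def)
    ultimately show ?thesis using False p ab by (intro exI[of _ "V \<inter> snd -` (- {0})"]) auto
  next
    case True
    obtain r where r: "r > 0" "ball a r \<times> ball 0 r \<subseteq> V"
      using open_real2_square[OF assms(1), of a 0] p ab True by metis
    \<comment> \<open>A square centred on the axis contains, with each point, the vertical segment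
      from it to the axis, over which the average is taken.\<close>
    define W where "W = ball a r \<times> ball (0::real) r"
    have W: "open W" "p \<in> W" "W \<subseteq> V"
      using r ab True by (auto simp: W_def intro: open_Times)
    have star: "(u, t * v) \<in> W" if "(u, v) \<in> W" "t \<in> {0..1}" for u v t
      using that mult_left_le_one_le[of "\<bar>v\<bar>" "\<bar>t\<bar>"] by (auto simp: W_def abs_mult)
    let ?f' = "partial_deriv (0, 1) f"
    have "C_class_on k (\<lambda>p. integral {0..1} (\<lambda>t. t ^ 0 *\<^sub>R ?f' (fst p, t * snd p))) W"
      using f[of "Suc k"] W(3)
      by (intro C_class_on_average W star) (auto simp: Basis_real2 intro: C_class_on_subset)
    hence "C_class_on k (quot_v f) W"
    proof (rule C_class_on_transform[OF _ W(1)])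
      fix q assume q: "q \<in> W"
      obtain u v where uv: "q = (u, v)" by (cases q)
      show "integral {0..1} (\<lambda>t. t ^ 0 *\<^sub>R ?f' (fst q, t * snd q)) = quot_v f q"
      proof (cases "v = 0")
        case True
        thus ?thesis using uv by (simp add: quot_v_def)
      next
        case False
        have "((\<lambda>t. v *\<^sub>R ?f' (u, t * v)) has_integral (f (u, 1 * v) - f (u, 0 * v))) {0..1}"
        proof (rule fundamental_theorem_of_calculus)
          fix t :: real assume t: "t \<in> {0..1}"
          have 1: "((\<lambda>v. f (u, v)) has_vector_derivative ?f' (u, t * v)) (at (t * v))"
            by (rule C_class_on_real2_derivs[OF f]) (use star[of u v t] q uv t W(3) in auto)
          have 2: "((\<lambda>t. t * v) has_vector_derivative v) (at t)"
            by (auto intro!: derivative_eq_intros simp: has_real_derivative_iff_has_vector_derivative[symmetric])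
          show "((\<lambda>t. f (u, t * v)) has_vector_derivative v *\<^sub>R ?f' (u, t * v)) (at t within {0..1})"
            using has_vector_derivative_at_within[OF vector_diff_chain_at[OF 2, OF 1]]
            by (simp only: o_def)
        qed simp
        moreover have "f (u, 0) = 0" using zero star[of u v 0] q uv W(3) by auto
        ultimately have "((\<lambda>t. v *\<^sub>R ?f' (u, t * v)) has_integral f (u, v)) {0..1}" by simp
        from has_integral_cmul[OF this, of "inverse v"]
        show ?thesis using False uv by (simp add: quot_v_def integral_unique)
      qed
    qed
    thus ?thesis using W by blast
  qed
qed

section \<open>Cauchy--Riemann pairs are smooth\<close>

definition CR_pair ::
    "(real \<times> real) set \<Rightarrow> (real \<times> real \<Rightarrow> 'c) \<Rightarrow> (real \<times> real \<Rightarrow> 'c::real_normed_vector) \<Rightarrow> bool"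
  where "CR_pair V a b \<longleftrightarrow> a differentiable_on V \<and> b differentiable_on V \<and>
    (\<forall>p\<in>V. partial_deriv (1, 0) a p = partial_deriv (0, 1) b p \<and>
           partial_deriv (0, 1) a p = - partial_deriv (1, 0) b p)"

lemma has_derivative_real2_partials:
  assumes "f differentiable (at p)"
  shows "(f has_derivative (\<lambda>h. fst h *\<^sub>R partial_deriv (1, 0) f p + snd h *\<^sub>R partial_deriv (0, 1) f p)) (at p)"
proof -
  obtain f' where f': "(f has_derivative f') (at p)" using assms by (auto simp: differentiable_def)
  interpret bounded_linear f' by (rule has_derivative_bounded_linear [OF f'])
  have "f' h = fst h *\<^sub>R f' (1, 0) + snd h *\<^sub>R f' (0, 1)" for h :: "real \<times> real"
    by (cases h) (simp flip: scaleR add)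
  thus ?thesis
    using f' has_derivative_imp_has_partial_deriv[OF f'] partial_deriv_eqI
    by (metis (no_types, lifting) ext)
qed

text \<open>The i-th coordinates of \<open>a\<close> and \<open>b\<close> satisfy the scalar
  Cauchy--Riemann equations, so they are the real and imaginary parts of a complex differentiable
  function. This opens the way to complex analysis for values in any Euclidean space.\<close>

lemma CR_pair_imp_holomorphic:
  fixes a b :: "real \<times> real \<Rightarrow> 'c::euclidean_space"
  assumes V: "open V" and ab: "CR_pair V a b" and z: "(Re z, Im z) \<in> V"
  shows "((\<lambda>z. Complex (a (Re z, Im z) \<bullet> i) (b (Re z, Im z) \<bullet> i)) has_field_derivative
     Complex (partial_deriv (1, 0) a (Re z, Im z) \<bullet> i) (partial_deriv (1, 0) b (Re z, Im z) \<bullet> i)) (at z)"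
proof -
  let ?p = "(Re z, Im z)"
  have d: "a differentiable (at ?p)" "b differentiable (at ?p)"
    using ab V z by (auto simp: CR_pair_def differentiable_on_eq_differentiable_at)
  have cr: "partial_deriv (1, 0) a ?p = partial_deriv (0, 1) b ?p"
    "partial_deriv (0, 1) a ?p = - partial_deriv (1, 0) b ?p"
    using ab z by (auto simp: CR_pair_def)
  have R: "((\<lambda>z. (Re z, Im z)) has_derivative (\<lambda>z. (Re z, Im z))) (at z)"
    by (auto intro!: derivative_eq_intros)
  have a: "((\<lambda>z. a (Re z, Im z) \<bullet> i) has_derivative
      (\<lambda>h. (Re h *\<^sub>R partial_deriv (1, 0) a ?p + Im h *\<^sub>R partial_deriv (0, 1) a ?p) \<bullet> i)) (at z)"
    using has_derivative_inner_left[OF has_derivative_compose[OF R has_derivative_real2_partials[OF d(1)]], of i]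
    by simp
  have b: "((\<lambda>z. b (Re z, Im z) \<bullet> i) has_derivative
      (\<lambda>h. (Re h *\<^sub>R partial_deriv (1, 0) b ?p + Im h *\<^sub>R partial_deriv (0, 1) b ?p) \<bullet> i)) (at z)"
    using has_derivative_inner_left[OF has_derivative_compose[OF R has_derivative_real2_partials[OF d(2)]], of i]
    by simp
  have "((\<lambda>z. complex_of_real (a (Re z, Im z) \<bullet> i) + \<i> * complex_of_real (b (Re z, Im z) \<bullet> i)) has_derivative
      (\<lambda>h. complex_of_real ((Re h *\<^sub>R partial_deriv (1, 0) a ?p + Im h *\<^sub>R partial_deriv (0, 1) a ?p) \<bullet> i)
       + \<i> * complex_of_real ((Re h *\<^sub>R partial_deriv (1, 0) b ?p + Im h *\<^sub>R partial_deriv (0, 1) b ?p) \<bullet> i))) (at z)"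
    by (intro has_derivative_add has_derivative_mult_right has_derivative_of_real a b)
  moreover have "(\<lambda>h. complex_of_real ((Re h *\<^sub>R partial_deriv (1, 0) a ?p + Im h *\<^sub>R partial_deriv (0, 1) a ?p) \<bullet> i)
       + \<i> * complex_of_real ((Re h *\<^sub>R partial_deriv (1, 0) b ?p + Im h *\<^sub>R partial_deriv (0, 1) b ?p) \<bullet> i))
     = (*) (Complex (partial_deriv (1, 0) a ?p \<bullet> i) (partial_deriv (1, 0) b ?p \<bullet> i))"
    by (rule ext) (simp add: complex_eq_iff cr(2) cr(1)[symmetric] inner_add_left algebra_simps)
  ultimately show ?thesis
    by (simp add: has_field_derivative_def Complex_eq)
qed

text \<open>The bootstrap from differentiable to smooth: the complex derivative of a holomorphic
  function is holomorphic, and coordinate by coordinate it is the pair of u-derivatives.\<close>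

lemma CR_pair_partial_deriv:
  fixes a b :: "real \<times> real \<Rightarrow> 'c::euclidean_space"
  assumes V: "open V" and ab: "CR_pair V a b"
  shows "CR_pair V (partial_deriv (1, 0) a) (partial_deriv (1, 0) b)"
proof -
  let ?a = "partial_deriv (1, 0) a" and ?b = "partial_deriv (1, 0) b"
  \<comment> \<open>\<open>w\<close> is the second complex derivative of the i-th coordinate
    function at \<open>p\<close>. The real and imaginary parts of its product with the increment are
    the derivatives of the two u-derivatives.\<close>
  define W where "W = (\<lambda>p i w. ((\<lambda>p. ?a p \<bullet> i) has_derivative (\<lambda>h. Re (w * Complex (fst h) (snd h)))) (at p) \<and>
            ((\<lambda>p. ?b p \<bullet> i) has_derivative (\<lambda>h. Im (w * Complex (fst h) (snd h)))) (at p))"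
  have ex: "\<exists>w. W p i w"
    if p: "p \<in> V" for p i
  proof -
    define Z where "Z = (\<lambda>z. (Re z, Im z)) -` V"
    have "open Z" unfolding Z_def by (intro open_vimage V continuous_intros)
    define F where "F = (\<lambda>z. Complex (a (Re z, Im z) \<bullet> i) (b (Re z, Im z) \<bullet> i))"
    have F: "(F has_field_derivative Complex (?a (Re z, Im z) \<bullet> i) (?b (Re z, Im z) \<bullet> i)) (at z)"
      if "z \<in> Z" for z
      unfolding F_def using CR_pair_imp_holomorphic[OF V ab] that Z_def by auto
    hence "F holomorphic_on Z"
      using \<open>open Z\<close> by (auto simp: holomorphic_on_open)
    hence "deriv F holomorphic_on Z" using \<open>open Z\<close> by (rule holomorphic_deriv)
    moreover have pZ: "Complex (fst p) (snd p) \<in> Z" using p by (simp add: Z_def)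
    ultimately have "(deriv F has_field_derivative deriv (deriv F) (Complex (fst p) (snd p)))
        (at (Complex (fst p) (snd p)))" using \<open>open Z\<close> by (blast intro: holomorphic_derivI)
    then obtain w where w: "(deriv F has_derivative (\<lambda>h. w * h)) (at (Complex (fst p) (snd p)))"
      by (auto simp: has_field_derivative_def)
    have "((\<lambda>p. complex_of_real (fst p) + \<i> * complex_of_real (snd p)) has_derivative
        (\<lambda>p. complex_of_real (fst p) + \<i> * complex_of_real (snd p))) (at p)"
      by (auto intro!: derivative_eq_intros)
    hence "((\<lambda>p. Complex (fst p) (snd p)) has_derivative (\<lambda>h. Complex (fst h) (snd h))) (at p)"
      by (simp add: Complex_eq)
    from has_derivative_compose[OF this w]
    have D: "((\<lambda>p. deriv F (Complex (fst p) (snd p))) has_derivative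
        (\<lambda>h. w * Complex (fst h) (snd h))) (at p)" .
    have eq: "deriv F (Complex (fst q) (snd q)) = Complex (?a q \<bullet> i) (?b q \<bullet> i)" if "q \<in> V" for q
      using DERIV_imp_deriv[OF F[of "Complex (fst q) (snd q)"]] that by (simp add: Z_def)
    have "((\<lambda>p. ?a p \<bullet> i) has_derivative (\<lambda>h. Re (w * Complex (fst h) (snd h)))) (at p)"
      by (rule has_derivative_transform_within_open[OF
            bounded_linear.has_derivative[OF bounded_linear_Re D] V p]) (simp add: eq)
    moreover have "((\<lambda>p. ?b p \<bullet> i) has_derivative (\<lambda>h. Im (w * Complex (fst h) (snd h)))) (at p)"
      by (rule has_derivative_transform_within_open[OF
            bounded_linear.has_derivative[OF bounded_linear_Im D] V p]) (simp add: eq)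
    ultimately show ?thesis unfolding W_def by blast
  qed
  define w where "w = (\<lambda>p i. SOME w. W p i w)"
  have w: "W p i (w p i)" if "p \<in> V" for p i
    unfolding w_def by (rule someI_ex[OF ex[OF that]])
  have wa: "\<And>p i. p \<in> V \<Longrightarrow> ((\<lambda>p. ?a p \<bullet> i) has_derivative (\<lambda>h. Re (w p i * Complex (fst h) (snd h)))) (at p)"
    and wb: "\<And>p i. p \<in> V \<Longrightarrow> ((\<lambda>p. ?b p \<bullet> i) has_derivative (\<lambda>h. Im (w p i * Complex (fst h) (snd h)))) (at p)"
    using w unfolding W_def by blast+
  have da: "?a differentiable (at p)" and db: "?b differentiable (at p)" if "p \<in> V" for p
    using wa[OF that] wb[OF that]
    unfolding differentiable_componentwise_within[of ?a] differentiable_componentwise_within[of ?b]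
    unfolding differentiable_def by blast+
  \<comment> \<open>Reads a coordinate of a partial derivative off \<open>w\<close>; the
    Cauchy--Riemann equations for the new pair then compare \<open>w\<close> with
    \<open>w * \<i>\<close>.\<close>
  have inner: "partial_deriv h f p \<bullet> i = f' h"
    if f: "f differentiable (at p)" "((\<lambda>p. f p \<bullet> i) has_derivative f') (at p)"
    for f :: "real \<times> real \<Rightarrow> 'c" and f' h p i
  proof -
    obtain g where g: "(f has_derivative g) (at p)" using f(1) by (auto simp: differentiable_def)
    have "(\<lambda>h. g h \<bullet> i) = f'"
      using has_derivative_unique[OF has_derivative_inner_left[OF g] f(2)] .
    thus ?thesis using partial_deriv_eqI[OF has_derivative_imp_has_partial_deriv[OF g]] by auto
  qed
  have "partial_deriv (1, 0) ?a p = partial_deriv (0, 1) ?b p \<and>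
        partial_deriv (0, 1) ?a p = - partial_deriv (1, 0) ?b p" if "p \<in> V" for p
    by (rule conjI; rule euclidean_eqI)
      (simp_all add: inner[OF da[OF that] wa[OF that]] inner[OF db[OF that] wb[OF that]])
  moreover have "?a differentiable_on V" "?b differentiable_on V"
    by (rule differentiable_at_imp_differentiable_on, erule da,
        rule differentiable_at_imp_differentiable_on, erule db)
  ultimately show ?thesis unfolding CR_pair_def by blast
qed

lemma differentiable_has_partial_deriv:
  assumes "f differentiable (at p)"
  shows "has_partial_deriv b f p (partial_deriv b f p)"
proof -
  obtain f' where f': "(f has_derivative f') (at p)" using assms by (auto simp: differentiable_def)
  from has_derivative_imp_has_partial_deriv[OF this, of b] show ?thesis
    using partial_deriv_eqI by metis
qed

text \<open>Up to sign, a v-derivative of one component is a u-derivative of the other, and the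
  u-derivatives form a Cauchy--Riemann pair again; hence the induction closes.\<close>

lemma CR_pair_C_class_on:
  fixes a b :: "real \<times> real \<Rightarrow> 'c::euclidean_space"
  assumes V: "open V"
  shows "CR_pair V a b \<Longrightarrow> C_class_on k a V \<and> C_class_on k b V"
proof (induction k arbitrary: a b)
  case 0
  thus ?case by (auto simp: CR_pair_def differentiable_imp_continuous_on)
next
  case (Suc k)
  let ?a = "partial_deriv (1, 0) a" and ?b = "partial_deriv (1, 0) b"
  have ab: "C_class_on k ?a V" "C_class_on k ?b V"
    using Suc.IH CR_pair_partial_deriv[OF V Suc.prems] by auto
  have cr: "partial_deriv (1, 0) a p = partial_deriv (0, 1) b p"
    "partial_deriv (0, 1) a p = - partial_deriv (1, 0) b p" if "p \<in> V" for p
    using Suc.prems that by (auto simp: CR_pair_def)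
  have d: "has_partial_deriv h a p (partial_deriv h a p)" "has_partial_deriv h b p (partial_deriv h b p)"
    if "p \<in> V" for p h
  proof -
    have "a differentiable (at p)" "b differentiable (at p)"
      using Suc.prems V that by (auto simp: CR_pair_def differentiable_on_eq_differentiable_at)
    thus "has_partial_deriv h a p (partial_deriv h a p)" "has_partial_deriv h b p (partial_deriv h b p)"
      by (blast intro: differentiable_has_partial_deriv)+
  qed
  have "C_class_on (Suc k) a V"
  proof (rule C_class_on_SucI[OF V, where f' = "\<lambda>h. if h = (1, 0) then ?a else (\<lambda>p. - ?b p)"])
    show "continuous_on V a"
      using Suc.prems by (simp add: CR_pair_def differentiable_imp_continuous_on)
    show "C_class_on k (if h = (1, 0) then ?a else (\<lambda>p. - ?b p)) V" for h
      using ab(1) C_class_on_bounded_linear[OF bounded_linear_minus[OF bounded_linear_ident] V ab(2)]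
      by simp
    fix h p assume "h \<in> (Basis :: (real \<times> real) set)" and p: "p \<in> V"
    thus "has_partial_deriv h a p ((if h = (1, 0) then ?a else (\<lambda>p. - ?b p)) p)"
      using d(1)[OF p, of h] cr(2)[OF p] by (cases "h = (1, 0)") (simp_all add: Basis_real2)
  qed
  moreover have "C_class_on (Suc k) b V"
  proof (rule C_class_on_SucI[OF V, where f' = "\<lambda>h. if h = (1, 0) then ?b else ?a"])
    show "continuous_on V b"
      using Suc.prems by (simp add: CR_pair_def differentiable_imp_continuous_on)
    show "C_class_on k (if h = (1, 0) then ?b else ?a) V" for h
      using ab by simp
    fix h p assume "h \<in> (Basis :: (real \<times> real) set)" and p: "p \<in> V"
    thus "has_partial_deriv h b p ((if h = (1, 0) then ?b else ?a) p)"
      using d(2)[OF p, of h] cr(1)[OF p] by (cases "h = (1, 0)") (simp_all add: Basis_real2)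
  qed
  ultimately show ?case by blast
qed

section \<open>The operators on axial pairs\<close>

text \<open>Provides the vector space of functions on which the abstract operators below will
  act.\<close>

instantiation "fun" :: (type, real_vector) real_vector
begin

definition scaleR_fun :: "real \<Rightarrow> ('a \<Rightarrow> 'b) \<Rightarrow> 'a \<Rightarrow> 'b"
  where "scaleR_fun c f = (\<lambda>x. c *\<^sub>R f x)"

instance
  by standard (simp_all add: scaleR_fun_def fun_eq_iff algebra_simps)

end

lemma scaleR_fun_apply [simp]: "(c *\<^sub>R f) x = c *\<^sub>R f x"
  by (simp add: scaleR_fun_def)

text \<open>
  \<open>P\<close>, \<open>Q\<close>, \<open>M\<close> stand for \<open>\<partial>\<^sub>u\<close>, \<open>v\<^sup>-\<^sup>1\<partial>\<^sub>v\<close> and multiplication by \<open>v\<^sup>2\<close> on even smooth functions,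
  and a pair \<open>(\<phi>, \<psi>)\<close> for the function \<open>\<phi>(x\<^sub>0, |y|) + y \<psi>(x\<^sub>0, |y|)\<close> of \<open>x = x\<^sub>0 + y\<close>. In these
  coordinates \<open>D\<close>, its conjugate and the Laplacian become \<open>DD\<close>, \<open>DB\<close>, \<open>DL\<close>, with \<open>N\<close> the number of
  generators.
\<close>

locale axial_operators =
  fixes E :: "'a::real_vector set" and P Q M :: "'a \<Rightarrow> 'a" and N :: real
  assumes subspace_E: "subspace E"
    and P_in: "\<phi> \<in> E \<Longrightarrow> P \<phi> \<in> E"
    and Q_in: "\<phi> \<in> E \<Longrightarrow> Q \<phi> \<in> E"
    and M_in: "\<phi> \<in> E \<Longrightarrow> M \<phi> \<in> E"
    and P_add: "\<phi> \<in> E \<Longrightarrow> \<psi> \<in> E \<Longrightarrow> P (\<phi> + \<psi>) = P \<phi> + P \<psi>"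
    and Q_add: "\<phi> \<in> E \<Longrightarrow> \<psi> \<in> E \<Longrightarrow> Q (\<phi> + \<psi>) = Q \<phi> + Q \<psi>"
    and M_add: "\<phi> \<in> E \<Longrightarrow> \<psi> \<in> E \<Longrightarrow> M (\<phi> + \<psi>) = M \<phi> + M \<psi>"
    and P_scaleR: "\<phi> \<in> E \<Longrightarrow> P (r *\<^sub>R \<phi>) = r *\<^sub>R P \<phi>"
    and Q_scaleR: "\<phi> \<in> E \<Longrightarrow> Q (r *\<^sub>R \<phi>) = r *\<^sub>R Q \<phi>"
    and M_scaleR: "\<phi> \<in> E \<Longrightarrow> M (r *\<^sub>R \<phi>) = r *\<^sub>R M \<phi>"
    and QP: "\<phi> \<in> E \<Longrightarrow> Q (P \<phi>) = P (Q \<phi>)"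
    and PM: "\<phi> \<in> E \<Longrightarrow> P (M \<phi>) = M (P \<phi>)"
    and QM: "\<phi> \<in> E \<Longrightarrow> Q (M \<phi>) = M (Q \<phi>) + 2 *\<^sub>R \<phi>"
begin

section \<open>The algebra of operators on axial pairs\<close>

lemma E_intros:
  "0 \<in> E" "\<phi> \<in> E \<Longrightarrow> \<psi> \<in> E \<Longrightarrow> \<phi> + \<psi> \<in> E" "\<phi> \<in> E \<Longrightarrow> \<psi> \<in> E \<Longrightarrow> \<phi> - \<psi> \<in> E"
  "\<phi> \<in> E \<Longrightarrow> r *\<^sub>R \<phi> \<in> E" "\<phi> \<in> E \<Longrightarrow> - \<phi> \<in> E"
  using subspace_E by (auto intro: subspace_0 subspace_add subspace_diff subspace_scale subspace_neg)

lemma minus_rules: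
  assumes "\<phi> \<in> E"
  shows "P (- \<phi>) = - P \<phi>" "Q (- \<phi>) = - Q \<phi>" "M (- \<phi>) = - M \<phi>"
  using assms P_scaleR[of \<phi> "-1"] Q_scaleR[of \<phi> "-1"] M_scaleR[of \<phi> "-1"] by simp_all

lemma diff_rules:
  assumes "\<phi> \<in> E" "\<psi> \<in> E"
  shows "P (\<phi> - \<psi>) = P \<phi> - P \<psi>" "Q (\<phi> - \<psi>) = Q \<phi> - Q \<psi>" "M (\<phi> - \<psi>) = M \<phi> - M \<psi>"
  using assms P_add[of \<phi> "- \<psi>"] Q_add[of \<phi> "- \<psi>"] M_add[of \<phi> "- \<psi>"]
  by (simp_all add: minus_rules E_intros)

lemma zero_rules: "P 0 = 0" "Q 0 = 0" "M 0 = 0"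
  using P_scaleR[of 0 0] Q_scaleR[of 0 0] M_scaleR[of 0 0] by (simp_all add: E_intros)

lemmas op_simps = P_in Q_in M_in E_intros P_add Q_add M_add P_scaleR Q_scaleR M_scaleR
  minus_rules diff_rules zero_rules QP PM QM

text \<open>Since \<open>\<partial>\<^sub>i\<close> of an even \<phi> is
  \<open>y\<^sub>i Q\<phi>\<close>, the vector part of D sends \<phi> to y Q\<phi>. On y \<psi> the
  N squares of generators give -N \<psi>, and y y = -|y|^2 gives -M (Q \<psi>).\<close>

definition DD :: "'a \<times> 'a \<Rightarrow> 'a \<times> 'a"
  where "DD = (\<lambda>(\<phi>, \<psi>). (P \<phi> - N *\<^sub>R \<psi> - M (Q \<psi>), P \<psi> + Q \<phi>))"

definition DB :: "'a \<times> 'a \<Rightarrow> 'a \<times> 'a"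
  where "DB = (\<lambda>(\<phi>, \<psi>). (P \<phi> + N *\<^sub>R \<psi> + M (Q \<psi>), P \<psi> - Q \<phi>))"

text \<open>The 2 added to \<open>N\<close> in the second component comes from the mixed terms in
  the Laplacian of y \<psi>, which add up to 2 y Q\<psi>.\<close>

definition DL :: "'a \<times> 'a \<Rightarrow> 'a \<times> 'a"
  where "DL = (\<lambda>(\<phi>, \<psi>). (P (P \<phi>) + N *\<^sub>R Q \<phi> + M (Q (Q \<phi>)),
                       P (P \<psi>) + (N + 2) *\<^sub>R Q \<psi> + M (Q (Q \<psi>))))"

lemma pair_ops_in:
  assumes "p \<in> E \<times> E"
  shows "DD p \<in> E \<times> E" "DB p \<in> E \<times> E" "DL p \<in> E \<times> E"
  using assms by (auto simp: DD_def DB_def DL_def op_simps)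

lemma funpow_pair_ops_in:
  assumes "p \<in> E \<times> E"
  shows "(DD ^^ k) p \<in> E \<times> E" "(DB ^^ k) p \<in> E \<times> E" "(DL ^^ k) p \<in> E \<times> E"
  by (induction k; use assms pair_ops_in in simp)+

text \<open>The mixed terms cancel because P commutes with Q and M; applying Q to M (Q \<psi>)
  yields the extra 2 Q\<psi> in the second component.\<close>

lemma DD_DB: "p \<in> E \<times> E \<Longrightarrow> DD (DB p) = DL p"
  and DB_DD: "p \<in> E \<times> E \<Longrightarrow> DB (DD p) = DL p"
  by (auto simp: DD_def DB_def DL_def op_simps algebra_simps scaleR_2)

text \<open>Associativity alone: \<open>DL\<close> is the product of \<open>DD\<close> and
  \<open>DB\<close> in either order.\<close>

lemma DD_DL: "p \<in> E \<times> E \<Longrightarrow> DD (DL p) = DL (DD p)"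
  using DD_DB[of "DD p"] DB_DD[of p] pair_ops_in[of p] by simp

lemma DB_DL: "p \<in> E \<times> E \<Longrightarrow> DB (DL p) = DL (DB p)"
  using DB_DD[of "DB p"] DD_DB[of p] pair_ops_in[of p] by simp

lemma DD_funpow_DL: "p \<in> E \<times> E \<Longrightarrow> DD ((DL ^^ k) p) = (DL ^^ k) (DD p)"
  by (induction k) (simp_all add: DD_DL funpow_pair_ops_in)

lemma DB_funpow_DL: "p \<in> E \<times> E \<Longrightarrow> DB ((DL ^^ k) p) = (DL ^^ k) (DB p)"
  by (induction k) (simp_all add: DB_DL funpow_pair_ops_in)

lemma funpow_DD_funpow_DL: "p \<in> E \<times> E \<Longrightarrow> (DD ^^ m) ((DL ^^ k) p) = (DL ^^ k) ((DD ^^ m) p)"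
  by (induction m) (simp_all add: DD_funpow_DL funpow_pair_ops_in)

lemma funpow_DB_funpow_DL: "p \<in> E \<times> E \<Longrightarrow> (DB ^^ m) ((DL ^^ k) p) = (DL ^^ k) ((DB ^^ m) p)"
  by (induction m) (simp_all add: DB_funpow_DL funpow_pair_ops_in)

text \<open>Peel off the outermost \<open>DD\<close> and the innermost \<open>DB\<close>: what lies
  between is a power of \<open>DL\<close>, which the outer \<open>DD\<close> passes to meet that
  \<open>DB\<close>.\<close>

lemma funpow_DD_funpow_DB: "p \<in> E \<times> E \<Longrightarrow> (DD ^^ m) ((DB ^^ m) p) = (DL ^^ m) p"
proof (induction m arbitrary: p)
  case (Suc m)
  have "(DD ^^ Suc m) ((DB ^^ Suc m) p) = DD ((DD ^^ m) ((DB ^^ m) (DB p)))"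
    by (simp add: funpow_swap1)
  also have "\<dots> = DD ((DL ^^ m) (DB p))"
    using Suc pair_ops_in by simp
  also have "\<dots> = (DL ^^ Suc m) p"
    using Suc.prems pair_ops_in by (simp add: DD_funpow_DL DD_DB funpow_swap1)
  finally show ?case .
qed simp

text \<open>There is one \<open>DD\<close> more than there are factors \<open>DB\<close>; the
  surplus one reaches \<open>p\<close> itself. This is the origin of the order of
  polyanalyticity.\<close>

lemma funpow_DD_DL_DB:
  assumes "p \<in> E \<times> E"
  shows "(DD ^^ Suc m) ((DL ^^ k) ((DB ^^ m) p)) = (DL ^^ (k + m)) (DD p)"
proof -
  have "(DD ^^ Suc m) ((DL ^^ k) ((DB ^^ m) p)) = (DL ^^ k) (DD ((DD ^^ m) ((DB ^^ m) p)))"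
    using assms by (simp add: funpow_DD_funpow_DL DD_funpow_DL funpow_pair_ops_in)
  also have "\<dots> = (DL ^^ (k + m)) (DD p)"
    using assms by (simp add: funpow_DD_funpow_DB DD_funpow_DL funpow_add)
  finally show ?thesis .
qed

text \<open>The equations for \<open>a\<close> and \<open>c\<close> are the Cauchy--Riemann equations of the pair \<open>(a, v c)\<close>.\<close>

context
  fixes a c
  assumes a: "a \<in> E" and c: "c \<in> E"
    and Pa: "P a = c + M (Q c)" and Qa: "Q a = - P c"
begin

text \<open>The Cauchy--Riemann equations cancel the terms with M and the whole vector component.
  Only scalar-type pairs occur from here on, so a single function has to be followed under
  \<open>DL\<close>.\<close>

lemma DD_holomorphic: "DD (a, c) = ((1 - N) *\<^sub>R c, 0)"
  by (simp add: DD_def Pa Qa algebra_simps)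

lemma funpow_Q_in: "(Q ^^ k) c \<in> E"
  by (induction k) (simp_all add: c Q_in)

text \<open>For k = 0 this says that v c is harmonic in (u, v), and it follows by
  cross-differentiating the two Cauchy--Riemann equations. Each further Q raises the constant 3 by
  2, because moving Q past M leaves the term 2.\<close>

lemma funpow_Q_equation:
  "P (P ((Q ^^ k) c)) + (2 * real k + 3) *\<^sub>R Q ((Q ^^ k) c) + M (Q (Q ((Q ^^ k) c))) = 0"
proof (induction k)
  case 0
  have "Q (P a) = P (Q a)" using QP a by simp
  hence "Q c + (M (Q (Q c)) + 2 *\<^sub>R Q c) = - P (P c)"
    using c by (simp add: Pa Qa op_simps)
  moreover have "3 *\<^sub>R Q c = Q c + 2 *\<^sub>R Q c"
    using scaleR_left_distrib[of 1 2 "Q c"] by simp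
  ultimately have "3 *\<^sub>R Q c + M (Q (Q c)) = - P (P c)" by (simp add: algebra_simps)
  thus ?case by (simp add: algebra_simps)
next
  case (Suc k)
  define d where "d = (Q ^^ k) c"
  have d: "d \<in> E" using funpow_Q_in by (simp add: d_def)
  have "Q (P (P d) + (2 * real k + 3) *\<^sub>R Q d + M (Q (Q d))) = Q 0"
    using Suc.IH by (simp add: d_def)
  hence "P (P (Q d)) + (2 * real k + 3) *\<^sub>R Q (Q d) + (M (Q (Q (Q d))) + 2 *\<^sub>R Q (Q d)) = 0"
    using d by (simp add: op_simps)
  moreover have "(2 * real (Suc k) + 3) *\<^sub>R Q (Q d) = (2 * real k + 3) *\<^sub>R Q (Q d) + 2 *\<^sub>R Q (Q d)"
    unfolding scaleR_left_distrib [symmetric] by simp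
  ultimately show ?case by (simp add: d_def [symmetric] add_ac)
qed

text \<open>The first component of \<open>DL\<close> and \<open>funpow_Q_equation\<close> differ
  only in the coefficient of Q: \<open>N\<close> against \<open>2 * k + 3\<close>.\<close>

lemma DL_funpow_Q: "DL (r *\<^sub>R (Q ^^ k) c, 0) = ((r * (N - 2 * real k - 3)) *\<^sub>R (Q ^^ Suc k) c, 0)"
proof -
  define d where "d = (Q ^^ k) c"
  have d: "d \<in> E" using funpow_Q_in by (simp add: d_def)
  have "P (P d) + N *\<^sub>R Q d + M (Q (Q d)) = (N - 2 * real k - 3) *\<^sub>R Q d"
    using funpow_Q_equation[of k] unfolding d_def[symmetric]
    by (simp add: algebra_simps add_eq_0_iff2)
  hence "r *\<^sub>R (P (P d) + N *\<^sub>R Q d + M (Q (Q d))) = (r * (N - 2 * real k - 3)) *\<^sub>R Q d"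
    by simp
  thus ?thesis
    using d by (simp add: d_def[symmetric] DL_def op_simps scaleR_add_right mult.commute)
qed

lemma funpow_DL_holomorphic:
  "(DL ^^ k) (r *\<^sub>R c, 0) = ((r * (\<Prod>j<k. N - 2 * real j - 3)) *\<^sub>R (Q ^^ k) c, 0)"
  by (induction k) (simp_all add: DL_funpow_Q mult.assoc del: scaleR_scaleR)

text \<open>Fueter--Sce: for \<open>N = 2 h + 1\<close> the last factor of the product vanishes.\<close>

lemma funpow_DL_DD_eq_0:
  assumes "h \<ge> 1" "N = 2 * real h + 1"
  shows "(DL ^^ h) (DD (a, c)) = (0, 0)"
proof -
  have "(\<Prod>j<h. N - 2 * real j - 3) = 0"
  proof (rule prod_zero)
    show "\<exists>j\<in>{..<h}. N - 2 * real j - 3 = 0"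
      using assms by (intro bexI[of _ "h - 1"]) (auto simp: of_nat_diff)
  qed simp
  thus ?thesis by (simp add: DD_holomorphic funpow_DL_holomorphic)
qed

lemma funpow_DD_holomorphic:
  assumes "k + m \<ge> 1" "N = 2 * real (k + m) + 1"
  shows "(DD ^^ Suc m) ((DL ^^ k) ((DB ^^ m) (a, c))) = (0, 0)"
  using funpow_DD_DL_DB[of "(a, c)" m k] funpow_DL_DD_eq_0[OF assms] a c by simp

end

end

section \<open>Even smooth functions\<close>

lemma eq_neg_imp_eq_0:
  fixes x :: "'a::real_vector"
  assumes "x = - x"
  shows "x = 0"
proof -
  have "2 *\<^sub>R x = 0" using assms by (simp add: scaleR_2 eq_neg_iff_add_eq_0)
  thus ?thesis by simp
qed

lemma C_class_on_sum:
  assumes "finite I" "open U" "\<And>i. i \<in> I \<Longrightarrow> C_class_on k (f i) U"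
  shows "C_class_on k (\<lambda>x. \<Sum>i\<in>I. f i x) U"
  using assms(1,3)
  by (induction I rule: finite_induct) (simp_all add: C_class_on_const C_class_on_add assms(2))

text \<open>Functions are extended by \<open>0\<close> outside \<open>V\<close>, so that equality on \<open>V\<close> is equality.\<close>

definition even_smooth :: "(real \<times> real) set \<Rightarrow> (real \<times> real \<Rightarrow> 'c::euclidean_space) set"
  where "even_smooth V = {\<phi>. smooth_on V \<phi> \<and> (\<forall>(u, v)\<in>V. \<phi> (u, - v) = \<phi> (u, v)) \<and> (\<forall>p. p \<notin> V \<longrightarrow> \<phi> p = 0)}"

definition restr :: "'a set \<Rightarrow> ('a \<Rightarrow> 'b::zero) \<Rightarrow> 'a \<Rightarrow> 'b"
  where "restr V f p = (if p \<in> V then f p else 0)"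

definition op_P :: "(real \<times> real) set \<Rightarrow> (real \<times> real \<Rightarrow> 'c) \<Rightarrow> real \<times> real \<Rightarrow> 'c::euclidean_space"
  where "op_P V \<phi> = restr V (partial_deriv (1, 0) \<phi>)"

definition op_Q :: "(real \<times> real) set \<Rightarrow> (real \<times> real \<Rightarrow> 'c) \<Rightarrow> real \<times> real \<Rightarrow> 'c::euclidean_space"
  where "op_Q V \<phi> = restr V (quot_v (partial_deriv (0, 1) \<phi>))"

text \<open>No \<open>restr\<close> here: a function that vanishes outside the domain keeps doing so
  after multiplication.\<close>

definition op_M :: "(real \<times> real \<Rightarrow> 'c) \<Rightarrow> real \<times> real \<Rightarrow> 'c::euclidean_space"
  where "op_M \<phi> p = (snd p * snd p) *\<^sub>R \<phi> p"

lemma smooth_on_restr: "open V \<Longrightarrow> smooth_on V f \<Longrightarrow> smooth_on V (restr V f)"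
  unfolding smooth_on_def by (metis C_class_on_transform restr_def)

locale symmetric_plane =
  fixes V :: "(real \<times> real) set"
  assumes open_V: "open V" and sym_V: "(u, v) \<in> V \<Longrightarrow> (u, - v) \<in> V"
begin

lemma even_smoothD:
  assumes "\<phi> \<in> even_smooth V"
  shows "smooth_on V \<phi>" "(u, v) \<in> V \<Longrightarrow> \<phi> (u, - v) = \<phi> (u, v)" "p \<notin> V \<Longrightarrow> \<phi> p = 0"
  using assms by (auto simp: even_smooth_def simp del: split_paired_All)

lemma even_smooth_continuous_on: "\<phi> \<in> even_smooth V \<Longrightarrow> continuous_on V \<phi>"
  using even_smoothD(1) C_class_on_imp_continuous_on smooth_on_def by blast

lemma even_smooth_restrI:
  assumes "smooth_on V f" "\<And>u v. (u, v) \<in> V \<Longrightarrow> f (u, - v) = f (u, v)"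
  shows "restr V f \<in> even_smooth V"
  using assms smooth_on_restr[OF open_V] sym_V by (auto simp: even_smooth_def restr_def)

lemma op_P_in:
  assumes "\<phi> \<in> even_smooth V"
  shows "op_P V \<phi> \<in> even_smooth V"
  unfolding op_P_def
proof (rule even_smooth_restrI)
  show "smooth_on V (partial_deriv (1, 0) \<phi>)"
    by (rule smooth_on_partial_deriv[OF even_smoothD(1)[OF assms]]) (simp add: Basis_real2)
  fix u v assume uv: "(u, v) \<in> V"
  have "partial_deriv (1, 0) \<phi> (u, - v) = partial_deriv (1, 0) (\<lambda>p. \<phi> (fst p, - snd p)) (u, v)"
    by (simp add: partial_deriv_def)
  also have "\<dots> = partial_deriv (1, 0) \<phi> (u, v)"
    by (rule partial_deriv_cong[OF open_V uv]) (use even_smoothD(2)[OF assms] in \<open>metis prod.collapse\<close>)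
  finally show "partial_deriv (1, 0) \<phi> (u, - v) = partial_deriv (1, 0) \<phi> (u, v)" .
qed

lemma partial_v_odd:
  assumes "\<phi> \<in> even_smooth V" "(u, v) \<in> V"
  shows "partial_deriv (0, 1) \<phi> (u, - v) = - partial_deriv (0, 1) \<phi> (u, v)"
proof -
  have 1: "((\<lambda>v. \<phi> (u, v)) has_vector_derivative partial_deriv (0, 1) \<phi> (u, - v)) (at (- v))"
    using smooth_on_has_partial_deriv[OF even_smoothD(1)[OF assms(1)] _ sym_V[OF assms(2)], of "(0, 1)"]
    unfolding has_partial_deriv_real2 by (simp add: Basis_real2)
  have 2: "(uminus has_vector_derivative - 1) (at v)"
    by (auto intro!: derivative_eq_intros)
  have "has_partial_deriv (0, 1) (\<lambda>p. \<phi> (fst p, - snd p)) (u, v) (- partial_deriv (0, 1) \<phi> (u, - v))"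
    using has_partial_deriv_real2(2)[of "\<lambda>p. \<phi> (fst p, - snd p)" u v "- partial_deriv (0, 1) \<phi> (u, - v)"]
      vector_diff_chain_at[OF 2, OF 1]
    by (simp add: o_def)
  hence "has_partial_deriv (0, 1) \<phi> (u, v) (- partial_deriv (0, 1) \<phi> (u, - v))"
    by (rule has_partial_deriv_transform[OF _ open_V assms(2)])
      (use even_smoothD(2)[OF assms(1)] in \<open>metis prod.collapse\<close>)
  from partial_deriv_eqI[OF this] show ?thesis by simp
qed

lemma partial_v_axis:
  assumes "\<phi> \<in> even_smooth V" "(u, 0) \<in> V"
  shows "partial_deriv (0, 1) \<phi> (u, 0) = 0"
  using partial_v_odd[OF assms] by (intro eq_neg_imp_eq_0) simp

text \<open>Oddness forces \<open>f\<close> to vanish on the axis, as Hadamard's lemma requires, and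
  dividing by the odd v makes the result even.\<close>

lemma quot_v_in:
  assumes "smooth_on V f" "\<And>u v. (u, v) \<in> V \<Longrightarrow> f (u, - v) = - f (u, v)"
  shows "restr V (quot_v f) \<in> even_smooth V"
proof (rule even_smooth_restrI)
  show "smooth_on V (quot_v f)"
  proof (rule smooth_on_quot_v[OF open_V assms(1)])
    fix u assume "(u, 0) \<in> V"
    from assms(2)[OF this] show "f (u, 0) = 0" by (intro eq_neg_imp_eq_0) simp
  qed
qed (auto simp: quot_v_def assms(2))

lemma op_Q_in:
  assumes "\<phi> \<in> even_smooth V"
  shows "op_Q V \<phi> \<in> even_smooth V"
  unfolding op_Q_def
proof (rule quot_v_in)
  show "smooth_on V (partial_deriv (0, 1) \<phi>)"
    by (rule smooth_on_partial_deriv[OF even_smoothD(1)[OF assms]]) (simp add: Basis_real2)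
qed (rule partial_v_odd[OF assms])

lemma has_partial_u:
  assumes "\<phi> \<in> even_smooth V" "p \<in> V"
  shows "has_partial_deriv (1, 0) \<phi> p (op_P V \<phi> p)"
  using smooth_on_has_partial_deriv[OF even_smoothD(1)[OF assms(1)] _ assms(2), of "(1, 0)"] assms(2)
  by (simp only: op_P_def restr_def Basis_real2 insert_iff simp_thms if_True)

text \<open>Stated without division, so that it holds on the axis too: there the v-derivative of an
  even function is 0.\<close>

lemma has_partial_v:
  assumes "\<phi> \<in> even_smooth V" "p \<in> V"
  shows "has_partial_deriv (0, 1) \<phi> p (snd p *\<^sub>R op_Q V \<phi> p)"
proof -
  have "snd p *\<^sub>R op_Q V \<phi> p = partial_deriv (0, 1) \<phi> p"
    using assms(2) partial_v_axis[OF assms(1), of "fst p"]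
    by (cases p) (auto simp: op_Q_def restr_def quot_v_def)
  thus ?thesis
    using smooth_on_has_partial_deriv[OF even_smoothD(1)[OF assms(1)] _ assms(2), of "(0, 1)"]
    by (simp only: Basis_real2 insert_iff simp_thms)
qed

lemma op_P_eqI:
  assumes "\<And>p. p \<in> V \<Longrightarrow> has_partial_deriv (1, 0) \<phi> p (\<psi> p)" "\<psi> \<in> even_smooth V"
  shows "op_P V \<phi> = \<psi>"
proof
  fix p
  show "op_P V \<phi> p = \<psi> p"
  proof (cases "p \<in> V")
    case True
    thus ?thesis using partial_deriv_eqI[OF assms(1)[OF True]] by (simp add: op_P_def restr_def)
  next
    case False
    thus ?thesis using even_smoothD(3)[OF assms(2) False] by (simp add: op_P_def restr_def)
  qed
qed

text \<open>Off the axis \<open>v Q\<phi>\<close> determines \<open>Q\<phi>\<close>, hence also on the axis by continuity.\<close>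

lemma op_Q_eqI:
  assumes \<phi>: "\<phi> \<in> even_smooth V" and \<psi>: "\<psi> \<in> even_smooth V"
    and *: "\<And>p. p \<in> V \<Longrightarrow> has_partial_deriv (0, 1) \<phi> p (snd p *\<^sub>R \<psi> p)"
  shows "op_Q V \<phi> = \<psi>"
proof
  fix p :: "real \<times> real"
  obtain u v where p: "p = (u, v)" by (cases p)
  have off: "op_Q V \<phi> q = \<psi> q" if "q \<in> V" "snd q \<noteq> 0" for q
    using partial_deriv_eqI[OF *[OF that(1)]] partial_deriv_eqI[OF has_partial_v[OF \<phi> that(1)]] that(2)
    by simp
  show "op_Q V \<phi> p = \<psi> p"
  proof (cases "p \<in> V \<and> v = 0")
    case True
    define h where "h = (\<lambda>q. op_Q V \<phi> q - \<psi> q)"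
    have "continuous_on V h"
      unfolding h_def by (intro continuous_intros even_smooth_continuous_on op_Q_in \<phi> \<psi>)
    hence "isCont h (u, 0)"
      using True p unfolding continuous_on_eq_continuous_at[OF open_V] by blast
    moreover have "isCont (\<lambda>v. (u, v)) 0" by (intro continuous_intros)
    ultimately have "isCont (h \<circ> (\<lambda>v. (u, v))) 0"
      using continuous_at_compose by blast
    hence "((\<lambda>v. h (u, v)) \<longlongrightarrow> h (u, 0)) (at 0)" by (simp add: isCont_def o_def)
    moreover have "((\<lambda>v. h (u, v)) \<longlongrightarrow> 0) (at 0)"
    proof (rule tendsto_eventually)
      have "open ((\<lambda>v. (u, v)) -` V)" by (intro open_vimage open_V continuous_intros)
      hence "eventually (\<lambda>v. v \<in> (\<lambda>v. (u, v)) -` V) (at 0)"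
        using True p by (intro eventually_at_in_open') auto
      moreover have "eventually (\<lambda>v. v \<noteq> (0::real)) (at 0)" by (rule eventually_neq_at_within)
      ultimately show "eventually (\<lambda>v. h (u, v) = 0) (at 0)"
        by eventually_elim (simp add: h_def off)
    qed
    ultimately have "h (u, 0) = 0" by (rule tendsto_unique[rotated]) simp
    thus ?thesis using True p by (simp add: h_def)
  next
    case False
    thus ?thesis using off[of p] p even_smoothD(3)[OF op_Q_in[OF \<phi>]] even_smoothD(3)[OF \<psi>]
      by (cases "p \<in> V") auto
  qed
qed

lemma subspace_even_smooth: "subspace (even_smooth V :: (real \<times> real \<Rightarrow> 'c::euclidean_space) set)"
proof (rule subspaceI)
  show "0 \<in> even_smooth V"
    by (simp add: even_smooth_def smooth_on_def zero_fun_def C_class_on_const[OF open_V])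
next
  fix \<phi> \<psi> :: "real \<times> real \<Rightarrow> 'c::euclidean_space"
  assume "\<phi> \<in> even_smooth V" "\<psi> \<in> even_smooth V"
  note * = even_smoothD[OF this(1)] even_smoothD[OF this(2)]
  have "smooth_on V (\<lambda>p. \<phi> p + \<psi> p)"
    using *(1,4) unfolding smooth_on_def by (intro allI C_class_on_add[OF open_V]) blast+
  thus "\<phi> + \<psi> \<in> even_smooth V"
    using * by (auto simp: even_smooth_def plus_fun_def)
next
  fix r and \<phi> :: "real \<times> real \<Rightarrow> 'c::euclidean_space" assume "\<phi> \<in> even_smooth V"
  thus "r *\<^sub>R \<phi> \<in> even_smooth V"
    by (auto simp: even_smooth_def smooth_on_def scaleR_fun_def
        C_class_on_bounded_linear[OF bounded_linear_scaleR_right open_V])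
qed

lemma op_M_in:
  assumes "\<phi> \<in> even_smooth V"
  shows "op_M \<phi> \<in> even_smooth V"
proof -
  have "C_class_on k (\<lambda>p. snd p *\<^sub>R (snd p *\<^sub>R \<phi> p)) V" for k
    using even_smoothD(1)[OF assms]
    unfolding smooth_on_def
    by (intro C_class_on_scaleR open_V C_class_on_linear_functional[OF bounded_linear_snd]) blast
  thus ?thesis
    using assms by (auto simp: even_smooth_def smooth_on_def op_M_def[abs_def])
qed

text \<open>By the uniqueness rules \<open>op_P_eqI\<close> and \<open>op_Q_eqI\<close>, each
  identity for P or Q becomes the computation of one partial derivative, with no division by
  v.\<close>

sublocale axial_operators "even_smooth V" "op_P V" "op_Q V" op_M N for N
proof
  fix \<phi> \<psi> :: "real \<times> real \<Rightarrow> 'c::euclidean_space" and r :: real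
  note in_E = op_P_in op_Q_in op_M_in subspace_add[OF subspace_even_smooth]
    subspace_scale[OF subspace_even_smooth]
  assume \<phi>: "\<phi> \<in> even_smooth V"
  show "op_P V \<phi> \<in> even_smooth V" "op_Q V \<phi> \<in> even_smooth V" "op_M \<phi> \<in> even_smooth V"
    using \<phi> by (rule in_E)+
  show "op_P V (r *\<^sub>R \<phi>) = r *\<^sub>R op_P V \<phi>"
  proof (rule op_P_eqI)
    fix p assume p: "p \<in> V"
    from bounded_linear.has_vector_derivative[OF bounded_linear_scaleR_right has_partial_u[OF \<phi> p]]
    show "has_partial_deriv (1, 0) (r *\<^sub>R \<phi>) p ((r *\<^sub>R op_P V \<phi>) p)"
      by (simp only: scaleR_fun_apply)
  qed (intro in_E \<phi>)
  show "op_Q V (r *\<^sub>R \<phi>) = r *\<^sub>R op_Q V \<phi>"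
  proof (rule op_Q_eqI)
    fix p assume p: "p \<in> V"
    from bounded_linear.has_vector_derivative[OF bounded_linear_scaleR_right has_partial_v[OF \<phi> p], of r]
    show "has_partial_deriv (0, 1) (r *\<^sub>R \<phi>) p (snd p *\<^sub>R (r *\<^sub>R op_Q V \<phi>) p)"
      by (simp add: mult.commute)
  qed (intro in_E \<phi>)+
  show "op_M (r *\<^sub>R \<phi>) = r *\<^sub>R op_M \<phi>"
    by (simp add: fun_eq_iff op_M_def mult_ac)
  show "op_P V (op_M \<phi>) = op_M (op_P V \<phi>)"
  proof (rule op_P_eqI)
    fix p assume p: "p \<in> V"
    from bounded_linear.has_vector_derivative[OF bounded_linear_scaleR_right has_partial_u[OF \<phi> p],
        of "snd p * snd p"]
    show "has_partial_deriv (1, 0) (op_M \<phi>) p (op_M (op_P V \<phi>) p)"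
      by (simp add: op_M_def)
  qed (intro in_E \<phi>)
  show "op_Q V (op_M \<phi>) = op_M (op_Q V \<phi>) + 2 *\<^sub>R \<phi>"
  proof (rule op_Q_eqI)
    fix p assume p: "p \<in> V"
    have "((\<lambda>t. (snd p + t) * (snd p + t)) has_field_derivative (2 * snd p)) (at 0)"
      by (auto intro!: derivative_eq_intros)
    from has_vector_derivative_scaleR[OF this has_partial_v[OF \<phi> p]]
    show "has_partial_deriv (0, 1) (op_M \<phi>) p (snd p *\<^sub>R (op_M (op_Q V \<phi>) + 2 *\<^sub>R \<phi>) p)"
      by (simp add: op_M_def algebra_simps flip: zero_prod_def)
  qed (intro in_E \<phi>)+
  show "op_Q V (op_P V \<phi>) = op_P V (op_Q V \<phi>)"
  proof (rule op_Q_eqI)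
    fix p assume p: "p \<in> V"
    let ?fu = "partial_deriv (1, 0) \<phi>" and ?fv = "partial_deriv (0, 1) \<phi>"
    have s: "smooth_on V ?fu"
      by (rule smooth_on_partial_deriv[OF even_smoothD(1)[OF \<phi>]]) (simp add: Basis_real2)
    \<comment> \<open>v is constant in direction u, so differentiating v Q\<phi>, the v-derivative
      of \<phi>, gives v P Q\<phi>. Schwarz's theorem then turns it into the v-derivative of
      P\<phi>.\<close>
    have "has_partial_deriv (1, 0) (\<lambda>q. snd q *\<^sub>R op_Q V \<phi> q) p (snd p *\<^sub>R op_P V (op_Q V \<phi>) p)"
      using bounded_linear.has_vector_derivative[OF bounded_linear_scaleR_right
          has_partial_u[OF op_Q_in[OF \<phi>] p], of "snd p"] by simp
    hence "has_partial_deriv (1, 0) ?fv p (snd p *\<^sub>R op_P V (op_Q V \<phi>) p)"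
      by (rule has_partial_deriv_transform[OF _ open_V p])
        (rule partial_deriv_eqI[OF has_partial_v[OF \<phi>], symmetric])
    hence "snd p *\<^sub>R op_P V (op_Q V \<phi>) p = partial_deriv (1, 0) ?fv p"
      by (rule partial_deriv_eqI[symmetric])
    also have "\<dots> = partial_deriv (0, 1) ?fu p"
      using even_smoothD(1)[OF \<phi>] by (intro partial_deriv_commute[OF open_V p]) (simp only: smooth_on_def)
    finally have "has_partial_deriv (0, 1) ?fu p (snd p *\<^sub>R op_P V (op_Q V \<phi>) p)"
      using smooth_on_has_partial_deriv[OF s _ p, of "(0, 1)"] by (simp only: Basis_real2 insert_iff simp_thms)
    thus "has_partial_deriv (0, 1) (op_P V \<phi>) p (snd p *\<^sub>R op_P V (op_Q V \<phi>) p)"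
      by (rule has_partial_deriv_transform[OF _ open_V p]) (simp add: op_P_def restr_def)
  qed (intro in_E \<phi>)+
  assume \<psi>: "\<psi> \<in> even_smooth V"
  show "op_P V (\<phi> + \<psi>) = op_P V \<phi> + op_P V \<psi>"
  proof (rule op_P_eqI)
    fix p assume p: "p \<in> V"
    from has_vector_derivative_add[OF has_partial_u[OF \<phi> p] has_partial_u[OF \<psi> p]]
    show "has_partial_deriv (1, 0) (\<phi> + \<psi>) p ((op_P V \<phi> + op_P V \<psi>) p)"
      by (simp only: plus_fun_apply)
  qed (intro in_E \<phi> \<psi>)
  show "op_Q V (\<phi> + \<psi>) = op_Q V \<phi> + op_Q V \<psi>"
  proof (rule op_Q_eqI)
    fix p assume p: "p \<in> V"
    from has_vector_derivative_add[OF has_partial_v[OF \<phi> p] has_partial_v[OF \<psi> p]]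
    show "has_partial_deriv (0, 1) (\<phi> + \<psi>) p (snd p *\<^sub>R (op_Q V \<phi> + op_Q V \<psi>) p)"
      by (simp only: plus_fun_apply scaleR_add_right)
  qed (intro in_E \<phi> \<psi>)+
  show "op_M (\<phi> + \<psi>) = op_M \<phi> + op_M \<psi>"
    by (rule ext) (simp add: op_M_def scaleR_add_right)
qed (rule subspace_even_smooth)

end

section \<open>Axial functions\<close>

lemma slice_domain_iff:
  fixes U :: "'n::finite point set"
  assumes "axially_symmetric U" "norm I = 1"
  shows "(u, v) \<in> slice_domain U \<longleftrightarrow> (u, v *\<^sub>R I) \<in> U"
proof
  assume *: "(u, v *\<^sub>R I) \<in> U"
  have "(u, v *\<^sub>R K) \<in> U" if K: "norm K = 1" for K
  proof -
    \<comment> \<open>\<open>axial_class\<close> uses only nonnegative radii, so the sign of a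
      negative \<open>v\<close> has to move into the direction.\<close>
    define K' where "K' = (if v \<ge> 0 then K else - K)"
    have "(u, \<bar>v\<bar> *\<^sub>R K') \<in> axial_class (u, v *\<^sub>R I)"
      unfolding axial_class_def using assms(2) K by (auto simp: K'_def)
    moreover have "\<bar>v\<bar> *\<^sub>R K' = v *\<^sub>R K" by (simp add: K'_def)
    ultimately show ?thesis using assms(1) * by (auto simp: axially_symmetric_def)
  qed
  thus "(u, v) \<in> slice_domain U" by (simp add: slice_domain_def)
qed (use assms in \<open>simp add: slice_domain_def\<close>)

lemma slice_domain_symmetric_plane:
  fixes U :: "'n::finite point set"
  assumes "open U" "axially_symmetric U"
  shows "symmetric_plane (slice_domain U)"
proof
  \<comment> \<open>Any unit vector serves, since one direction already decides membership;
    \<open>undefined\<close> is merely some index.\<close>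
  define I :: "real ^ 'n" where "I = axis undefined 1"
  have I: "norm I = 1" by (simp add: I_def)
  have "slice_domain U = (\<lambda>(u, v). (u, v *\<^sub>R I)) -` U"
    using slice_domain_iff[OF assms(2) I] by auto
  moreover have "open ((\<lambda>(u, v). (u, v *\<^sub>R I)) -` U)"
    unfolding case_prod_unfold by (intro open_vimage assms continuous_intros)
  ultimately show "open (slice_domain U)" by simp
  show "(u, - v) \<in> slice_domain U" if "(u, v) \<in> slice_domain U" for u v
    using that slice_domain_iff[OF assms(2) I, of u v] slice_domain_iff[OF assms(2), of "- I" u "- v"] I
    by simp
qed

lemma norm_mem_slice_domain:
  fixes U :: "'n::finite point set"
  assumes "axially_symmetric U" "x \<in> U"
  shows "(fst x, norm (snd x)) \<in> slice_domain U"
proof (cases "snd x = 0")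
  case True
  define I :: "real ^ 'n" where "I = axis undefined 1"
  have "norm I = 1" by (simp add: I_def)
  from slice_domain_iff[OF assms(1) this, of "fst x" 0] show ?thesis
    using True assms(2) by (metis norm_zero prod.collapse scaleR_zero_left)
next
  case False
  hence "norm (snd x /\<^sub>R norm (snd x)) = 1" by simp
  from slice_domain_iff[OF assms(1) this, of "fst x" "norm (snd x)"] show ?thesis
    using False assms(2) by simp
qed

text \<open>
  \<open>J i\<close> is multiplication by \<open>e\<^sub>i\<close> from the left or from the right; the two cases of the theorem are
  instances of the same argument.
\<close>

locale clifford_action =
  fixes J :: "'n::finite \<Rightarrow> 'c::euclidean_space \<Rightarrow> 'c"
  assumes bounded_linear_J: "bounded_linear (J i)"
    and J_square: "J i (J i a) = - a"
    and J_anticommute: "i \<noteq> j \<Longrightarrow> J i (J j a) = - J j (J i a)"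
begin

lemma J_simps:
  "J i (a + b) = J i a + J i b" "J i (r *\<^sub>R a) = r *\<^sub>R J i a" "J i (sum g A) = (\<Sum>x\<in>A. J i (g x))"
  using bounded_linear.linear[OF bounded_linear_J[of i]]
  by (simp_all add: linear_add linear_scale linear_sum)

text \<open>Clifford multiplication by the vector \<open>y\<close>, from the side that
  \<open>J\<close> encodes.\<close>

definition vJ :: "real ^ 'n \<Rightarrow> 'c \<Rightarrow> 'c"
  where "vJ y a = (\<Sum>i\<in>UNIV. (y $ i) *\<^sub>R J i a)"

lemma vJ_simps:
  "vJ y (a + b) = vJ y a + vJ y b" "vJ y (r *\<^sub>R a) = r *\<^sub>R vJ y a"
  "vJ (y + z) a = vJ y a + vJ z a" "vJ (r *\<^sub>R y) a = r *\<^sub>R vJ y a"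
  "vJ (axis i 1) a = J i a" "vJ 0 a = 0"
  by (simp_all add: vJ_def J_simps algebra_simps sum.distrib scaleR_sum_right axis_def if_distrib
      if_distribR cong: if_cong)

lemma vJ_zero: "vJ y 0 = 0"
  using vJ_simps(2)[of y 0 0] by simp

lemma bounded_linear_vJ: "bounded_linear (vJ y)"
  by (intro linear_conv_bounded_linear[THEN iffD1] linearI) (simp_all add: vJ_simps)

text \<open>Adding the double sum to its transpose cancels the off-diagonal terms by anticommutation
  and leaves twice the diagonal.\<close>

lemma vJ_square: "vJ y (vJ y a) = - ((norm y)\<^sup>2 *\<^sub>R a)"
proof -
  define S where "S = (\<Sum>i\<in>UNIV. \<Sum>j\<in>UNIV. (y $ i * y $ j) *\<^sub>R J i (J j a))"
  have S: "vJ y (vJ y a) = S"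
    by (simp add: vJ_def S_def J_simps scaleR_sum_right)
  have "S = (\<Sum>i\<in>UNIV. \<Sum>j\<in>UNIV. (y $ i * y $ j) *\<^sub>R J j (J i a))"
    unfolding S_def by (subst sum.swap) (simp add: mult.commute)
  hence "S + S = (\<Sum>i\<in>UNIV. \<Sum>j\<in>UNIV. (y $ i * y $ j) *\<^sub>R (J i (J j a) + J j (J i a)))"
    unfolding S_def by (simp add: sum.distrib scaleR_add_right)
  also have "\<dots> = (\<Sum>i\<in>UNIV. \<Sum>j\<in>UNIV. if j = i then - (2 * (y $ i)\<^sup>2) *\<^sub>R a else 0)"
  proof (intro sum.cong refl)
    fix i j
    show "(y $ i * y $ j) *\<^sub>R (J i (J j a) + J j (J i a)) = (if j = i then - (2 * (y $ i)\<^sup>2) *\<^sub>R a else 0)"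
    proof (cases "j = i")
      case True
      have "- a - a = (- 2) *\<^sub>R a" by (simp add: scaleR_2)
      thus ?thesis using True by (simp add: J_square power2_eq_square)
    next
      case False
      hence "J i (J j a) = - J j (J i a)" by (intro J_anticommute) auto
      thus ?thesis using False by simp
    qed
  qed
  also have "\<dots> = (\<Sum>i\<in>UNIV. - (2 * (y $ i)\<^sup>2)) *\<^sub>R a"
    by (simp add: scaleR_sum_left)
  also have "(\<Sum>i\<in>UNIV. - (2 * (y $ i)\<^sup>2)) = - (2 * (norm y)\<^sup>2)"
    by (simp add: norm_vec_def L2_set_def sum_nonneg sum_distrib_left sum_negf)
  finally have "2 *\<^sub>R S = 2 *\<^sub>R (- ((norm y)\<^sup>2 *\<^sub>R a))" by (simp add: scaleR_2 [of S])
  hence "S = - ((norm y)\<^sup>2 *\<^sub>R a)" by (rule scaleR_left_imp_eq [rotated]) simp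
  thus ?thesis using S by simp
qed

definition DJ :: "('n point \<Rightarrow> 'c) \<Rightarrow> 'n point \<Rightarrow> 'c"
  where "DJ f x = partial_0 f x + (\<Sum>i\<in>UNIV. J i (partial_i i f x))"

definition DJbar :: "('n point \<Rightarrow> 'c) \<Rightarrow> 'n point \<Rightarrow> 'c"
  where "DJbar f x = partial_0 f x - (\<Sum>i\<in>UNIV. J i (partial_i i f x))"

end

section \<open>Axial functions and their derivatives\<close>

locale axial_domain = clifford_action J
  for J :: "'n::finite \<Rightarrow> 'c::euclidean_space \<Rightarrow> 'c" +
  fixes U :: "'n point set"
  assumes open_U: "open U" and axial_U: "axially_symmetric U"
begin

abbreviation V where "V \<equiv> slice_domain U"

sublocale symmetric_plane V
  by (rule slice_domain_symmetric_plane[OF open_U axial_U])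

definition rad :: "(real \<times> real \<Rightarrow> 'c) \<Rightarrow> 'n point \<Rightarrow> 'c"
  where "rad \<phi> x = \<phi> (fst x, norm (snd x))"

definition Ax :: "(real \<times> real \<Rightarrow> 'c) \<times> (real \<times> real \<Rightarrow> 'c) \<Rightarrow> 'n point \<Rightarrow> 'c"
  where "Ax p x = rad (fst p) x + vJ (snd x) (rad (snd p) x)"

abbreviation EE :: "((real \<times> real \<Rightarrow> 'c) \<times> (real \<times> real \<Rightarrow> 'c)) set"
  where "EE \<equiv> even_smooth V \<times> even_smooth V"

lemma rad_partial_0:
  assumes "\<phi> \<in> even_smooth V" "x \<in> U"
  shows "has_partial_deriv (1, 0) (rad \<phi>) x (rad (op_P V \<phi>) x)"
  using has_partial_u[OF assms(1) norm_mem_slice_domain[OF axial_U assms(2)]]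
  by (simp add: rad_def)

text \<open>The factor |y| in the v-derivative |y| Q\<phi> cancels the denominator of the derivative
  y_i / |y| of the norm; this is why Q is the natural operator.\<close>

lemma rad_partial_i:
  assumes \<phi>: "\<phi> \<in> even_smooth V" and x: "x \<in> U"
  shows "has_partial_deriv (0, axis i 1) (rad \<phi>) x ((snd x $ i) *\<^sub>R rad (op_Q V \<phi>) x)"
proof (cases "snd x = 0")
  case False
  have "((\<lambda>t. snd x + t *\<^sub>R axis i 1) has_derivative (\<lambda>t. t *\<^sub>R axis i 1)) (at 0)"
    by (auto intro!: derivative_eq_intros)
  moreover have "(norm has_derivative (\<lambda>h. h \<bullet> sgn (snd x))) (at (snd x + 0 *\<^sub>R axis i 1))"
    using has_derivative_norm[OF False] by (simp add: inner_commute)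
  ultimately have "((\<lambda>t. norm (snd x + t *\<^sub>R axis i 1)) has_derivative (\<lambda>t. (t *\<^sub>R axis i 1) \<bullet> sgn (snd x))) (at 0)"
    by (rule has_derivative_compose)
  moreover have "axis i 1 \<bullet> sgn (snd x) = snd x $ i / norm (snd x)"
    by (simp add: inner_axis' sgn_div_norm divide_inverse mult.commute)
  ultimately have 1: "((\<lambda>t. norm (snd x + t *\<^sub>R axis i 1)) has_vector_derivative (snd x $ i / norm (snd x))) (at 0)"
    by (simp add: has_vector_derivative_def)
  have 2: "((\<lambda>v. \<phi> (fst x, v)) has_vector_derivative norm (snd x) *\<^sub>R rad (op_Q V \<phi>) x)
      (at (norm (snd x + 0 *\<^sub>R axis i 1)))"
    using has_partial_v[OF \<phi> norm_mem_slice_domain[OF axial_U x]]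
    unfolding has_partial_deriv_real2 by (simp add: rad_def)
  show ?thesis
    using vector_diff_chain_at[OF 1, OF 2] False by (simp add: o_def rad_def)
next
  case True
  have x0: "(fst x, 0) \<in> V" using norm_mem_slice_domain[OF axial_U x] True by simp
  have "((\<lambda>t. \<phi> (fst x, t)) has_vector_derivative 0) (at 0)"
    using has_partial_v[OF \<phi> x0] unfolding has_partial_deriv_real2 by simp
  \<comment> \<open>The norm is not differentiable at 0, but evenness allows |t| to be replaced by
    t, and the v-derivative on the axis is 0.\<close>
  hence "((\<lambda>t. \<phi> (fst x, norm (t *\<^sub>R axis i (1::real)))) has_vector_derivative 0) (at 0)"
  proof (rule has_vector_derivative_transform_within_open[where S = "(\<lambda>t. (fst x, t)) -` V"])
    show "open ((\<lambda>t. (fst x, t)) -` V)" by (intro open_vimage open_V continuous_intros)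
    show "\<phi> (fst x, t) = \<phi> (fst x, norm (t *\<^sub>R axis i (1::real)))" if "t \<in> (\<lambda>t. (fst x, t)) -` V" for t
      using that even_smoothD(2)[OF \<phi>, of "fst x" t] by (auto simp: abs_if)
  qed (use x0 in simp)
  thus ?thesis using True by (simp add: rad_def)
qed

lemma Ax_partial_0:
  assumes "p \<in> EE" "x \<in> U"
  shows "has_partial_deriv (1, 0) (Ax p) x (rad (op_P V (fst p)) x + vJ (snd x) (rad (op_P V (snd p)) x))"
proof -
  have p: "fst p \<in> even_smooth V" "snd p \<in> even_smooth V" using assms by auto
  have "snd (x + t *\<^sub>R (1, 0)) = snd x" for t by simp
  thus ?thesis
    using has_vector_derivative_add[OF rad_partial_0[OF p(1) assms(2)]
        bounded_linear.has_vector_derivative[OF bounded_linear_vJ rad_partial_0[OF p(2) assms(2)]], of "snd x"]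
    unfolding Ax_def by (simp only:)
qed

lemma Ax_partial_i:
  assumes "p \<in> EE" "x \<in> U"
  shows "has_partial_deriv (0, axis i 1) (Ax p) x
    ((snd x $ i) *\<^sub>R Ax (op_Q V (fst p), op_Q V (snd p)) x + J i (rad (snd p) x))"
proof -
  have p: "fst p \<in> even_smooth V" "snd p \<in> even_smooth V" using assms by auto
  note d = rad_partial_i[OF p(1) assms(2), of i] rad_partial_i[OF p(2) assms(2), of i]
  have "((\<lambda>t. t) has_field_derivative 1) (at (0::real))" by simp
  from has_vector_derivative_add[OF
      has_vector_derivative_add[OF d(1) bounded_linear.has_vector_derivative[OF bounded_linear_vJ d(2), of "snd x"]]
      has_vector_derivative_scaleR[OF this bounded_linear.has_vector_derivative[OF bounded_linear_J d(2), of i]]]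
  show ?thesis
    by (simp add: Ax_def vJ_simps algebra_simps flip: zero_prod_def)
qed

lemma partial_Ax:
  assumes "p \<in> EE" "x \<in> U"
  shows "partial_0 (Ax p) x = Ax (op_P V (fst p), op_P V (snd p)) x"
    and "partial_i i (Ax p) x =
      (snd x $ i) *\<^sub>R Ax (op_Q V (fst p), op_Q V (snd p)) x + J i (rad (snd p) x)"
proof -
  have "partial_0 (Ax p) x = rad (op_P V (fst p)) x + vJ (snd x) (rad (op_P V (snd p)) x)"
    by (rule partial_deriv_eqI[OF Ax_partial_0[OF assms]])
  thus "partial_0 (Ax p) x = Ax (op_P V (fst p), op_P V (snd p)) x" by (simp add: Ax_def)
qed (rule partial_deriv_eqI[OF Ax_partial_i[OF assms]])

lemma DJ_cong:
  assumes "\<And>y. y \<in> U \<Longrightarrow> f y = g y" "x \<in> U"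
  shows "DJ f x = DJ g x" "DJbar f x = DJbar g x"
  using partial_deriv_cong[OF open_U assms(2) assms(1)] by (simp_all add: DJ_def DJbar_def)

lemma laplacian_cong:
  fixes f g :: "'n point \<Rightarrow> 'c"
  assumes "\<And>y. y \<in> U \<Longrightarrow> f y = g y" "x \<in> U"
  shows "laplacian f x = laplacian g x"
proof -
  have "partial_deriv b (partial_deriv b f) x = partial_deriv b (partial_deriv b g) x" for b
    by (intro partial_deriv_cong[OF open_U assms(2)] partial_deriv_cong[OF open_U] assms(1))
  thus ?thesis by (simp add: laplacian_def)
qed

text \<open>The two places where multiplication is squared: \<open>J_square\<close>, summed over all
  generators, contributes the dimension, and \<open>vJ_square\<close> the factor |y|^2.\<close>

lemma sum_J_partial_i_Ax:
  assumes "p \<in> EE" "x \<in> U"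
  shows "(\<Sum>i\<in>UNIV. J i (partial_i i (Ax p) x)) =
    vJ (snd x) (rad (op_Q V (fst p)) x) - (norm (snd x))\<^sup>2 *\<^sub>R rad (op_Q V (snd p)) x
    - real CARD('n) *\<^sub>R rad (snd p) x"
proof -
  let ?g = "Ax (op_Q V (fst p), op_Q V (snd p)) x"
  have "(\<Sum>i\<in>UNIV. J i (partial_i i (Ax p) x)) =
      (\<Sum>i\<in>UNIV. (snd x $ i) *\<^sub>R J i ?g) + (\<Sum>i\<in>(UNIV::'n set). - rad (snd p) x)"
    by (simp add: partial_Ax(2)[OF assms] J_simps J_square sum_subtractf sum_negf)
  also have "\<dots> = vJ (snd x) ?g - real CARD('n) *\<^sub>R rad (snd p) x"
    by (simp add: vJ_def scaleR_conv_of_real sum_constant_scaleR)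
  finally show ?thesis by (simp add: Ax_def vJ_simps vJ_square)
qed

lemma DJ_Ax:
  assumes "p \<in> EE" "x \<in> U"
  shows "DJ (Ax p) x = Ax (DD (real CARD('n)) p) x"
    and "DJbar (Ax p) x = Ax (DB (real CARD('n)) p) x"
  unfolding DJ_def DJbar_def partial_Ax(1)[OF assms] sum_J_partial_i_Ax[OF assms]
  by (simp_all add: DD_def DB_def Ax_def rad_def op_M_def case_prod_unfold
      power2_eq_square vJ_simps algebra_simps linear_diff[OF bounded_linear.linear[OF bounded_linear_vJ]])

lemma laplacian_Ax:
  assumes "p \<in> EE" "x \<in> U"
  shows "laplacian (Ax p) x = Ax (DL (real CARD('n)) p) x"
proof -
  let ?P = "\<lambda>p. (op_P V (fst p), op_P V (snd p))" and ?Q = "\<lambda>p. (op_Q V (fst p), op_Q V (snd p))"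
  have in_EE: "?P p \<in> EE" "?Q p \<in> EE" if "p \<in> EE" for p
    using that by (auto intro: op_P_in op_Q_in)
  have p2: "snd p \<in> even_smooth V" using assms by auto
  have "partial_0 (partial_0 (Ax p)) x = partial_0 (Ax (?P p)) x"
    by (rule partial_deriv_cong[OF open_U assms(2) partial_Ax(1)[OF assms(1)]])
  also have "\<dots> = Ax (?P (?P p)) x" by (rule partial_Ax(1)[OF in_EE(1)[OF assms(1)] assms(2)])
  finally have d0: "partial_0 (partial_0 (Ax p)) x = Ax (?P (?P p)) x" .
  \<comment> \<open>The last term arises twice: from the explicit vector factor y in
    \<open>Ax (?Q p)\<close>, and from differentiating the radial function under \<open>J i\<close>.
    Summed over i, this is the 2 in \<open>N + 2\<close>.\<close>
  have di: "partial_i i (partial_i i (Ax p)) x =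
      (snd x $ i)\<^sup>2 *\<^sub>R Ax (?Q (?Q p)) x + Ax (?Q p) x + 2 *\<^sub>R ((snd x $ i) *\<^sub>R J i (rad (op_Q V (snd p)) x))"
    for i
  proof -
    let ?b = "(0, axis i 1) :: 'n point" and ?Z = "(snd x $ i) *\<^sub>R J i (rad (op_Q V (snd p)) x)"
    have "((\<lambda>t. snd x $ i + t) has_field_derivative 1) (at 0)"
      by (auto intro!: derivative_eq_intros)
    from has_vector_derivative_add[OF
        has_vector_derivative_scaleR[OF this Ax_partial_i[OF in_EE(2)[OF assms(1)] assms(2), of i]]
        bounded_linear.has_vector_derivative[OF bounded_linear_J rad_partial_i[OF p2 assms(2), of i], of i]]
    have "has_partial_deriv ?b (\<lambda>y. (snd y $ i) *\<^sub>R Ax (?Q p) y + J i (rad (snd p) y)) x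
      ((snd x $ i)\<^sup>2 *\<^sub>R Ax (?Q (?Q p)) x + Ax (?Q p) x + (?Z + ?Z))"
      by (simp add: J_simps algebra_simps power2_eq_square flip: zero_prod_def)
    hence "has_partial_deriv ?b (partial_i i (Ax p)) x
      ((snd x $ i)\<^sup>2 *\<^sub>R Ax (?Q (?Q p)) x + Ax (?Q p) x + (?Z + ?Z))"
      by (rule has_partial_deriv_transform[OF _ open_U assms(2)])
        (rule partial_Ax(2)[OF assms(1), symmetric])
    from partial_deriv_eqI[OF this] show ?thesis by (simp only: scaleR_2)
  qed
  have "(norm (snd x))\<^sup>2 = (\<Sum>i\<in>UNIV. (snd x $ i)\<^sup>2)"
    by (simp add: norm_vec_def L2_set_def sum_nonneg)
  hence "(\<Sum>i\<in>UNIV. partial_i i (partial_i i (Ax p)) x) =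
      (norm (snd x))\<^sup>2 *\<^sub>R Ax (?Q (?Q p)) x + real CARD('n) *\<^sub>R Ax (?Q p) x + 2 *\<^sub>R vJ (snd x) (rad (op_Q V (snd p)) x)"
    by (simp only: di sum.distrib scaleR_sum_left [symmetric] scaleR_sum_right [symmetric] vJ_def
        sum_constant_scaleR)
  thus ?thesis
    unfolding laplacian_def d0
    by (simp add: DL_def Ax_def rad_def op_M_def case_prod_unfold power2_eq_square vJ_simps algebra_simps)
qed

lemma funpow_Ax:
  assumes p: "p \<in> EE" and g: "\<And>x. x \<in> U \<Longrightarrow> g x = Ax p x"
  shows "x \<in> U \<Longrightarrow> (DJ ^^ k) g x = Ax ((DD (real CARD('n)) ^^ k) p) x"
    and "x \<in> U \<Longrightarrow> (DJbar ^^ k) g x = Ax ((DB (real CARD('n)) ^^ k) p) x"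
    and "x \<in> U \<Longrightarrow> (laplacian ^^ k) g x = Ax ((DL (real CARD('n)) ^^ k) p) x"
proof (induction k arbitrary: x)
  case (Suc k)
  case 1
  show ?case using DJ_cong(1)[OF Suc(1) 1] DJ_Ax(1)[OF funpow_pair_ops_in(1)[OF p] 1] by simp
next
  case (Suc k)
  case 2
  show ?case using DJ_cong(2)[OF Suc(2) 2] DJ_Ax(2)[OF funpow_pair_ops_in(2)[OF p] 2] by simp
next
  case (Suc k)
  case 3
  show ?case using laplacian_cong[OF Suc(3) 3] laplacian_Ax[OF funpow_pair_ops_in(3)[OF p] 3] by simp
qed (use g in auto)

text \<open>The norm is not smooth at real points, so composition is of no use there. Instead, each
  partial derivative is again radial up to a coordinate factor, which lets the induction run over
  all even \<phi>.\<close>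

lemma C_class_on_rad: "\<phi> \<in> even_smooth V \<Longrightarrow> C_class_on k (rad \<phi>) U"
proof (induction k arbitrary: \<phi>)
  have cont: "continuous_on U (rad \<phi>)" if "\<phi> \<in> even_smooth V" for \<phi>
    unfolding rad_def
    by (rule continuous_on_compose2[OF even_smooth_continuous_on[OF that]])
      (auto intro!: continuous_intros norm_mem_slice_domain[OF axial_U])
  {
    case 0
    thus ?case using cont by simp
  next
    case (Suc k)
    have lin: "bounded_linear (\<lambda>x :: 'n point. snd x \<bullet> b)" for b
      by (intro bounded_linear_compose[OF bounded_linear_inner_left bounded_linear_snd])
    show ?case
    proof (rule C_class_on_SucI[OF open_U cont[OF Suc.prems], where f' =
          "\<lambda>b. if b = (1, 0) then rad (op_P V \<phi>) else (\<lambda>x. (snd x \<bullet> snd b) *\<^sub>R rad (op_Q V \<phi>) x)"])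
      show "C_class_on k (if b = (1, 0) then rad (op_P V \<phi>)
          else (\<lambda>x. (snd x \<bullet> snd b) *\<^sub>R rad (op_Q V \<phi>) x)) U" for b
        using Suc.IH[OF op_P_in[OF Suc.prems]]
          C_class_on_scaleR[OF open_U C_class_on_linear_functional[OF lin open_U] Suc.IH[OF op_Q_in[OF Suc.prems]]]
        by simp
      fix b x assume b: "b \<in> (Basis :: 'n point set)" and x: "x \<in> U"
      consider "b = (1, 0)" | i where "b = (0, axis i 1)"
        using b by (auto simp: Basis_prod_def Basis_vec_def)
      thus "has_partial_deriv b (rad \<phi>) x ((if b = (1, 0) then rad (op_P V \<phi>)
          else (\<lambda>x. (snd x \<bullet> snd b) *\<^sub>R rad (op_Q V \<phi>) x)) x)"
      proof cases
        case 1
        thus ?thesis using rad_partial_0[OF Suc.prems x] by simp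
      next
        case (2 i)
        thus ?thesis using rad_partial_i[OF Suc.prems x, of i] by (simp add: inner_axis)
      qed
    qed
  }
qed

lemma C_class_on_Ax:
  assumes "p \<in> EE"
  shows "C_class_on k (Ax p) U"
proof -
  have lin: "bounded_linear (\<lambda>x :: 'n point. snd x $ i)" for i
    by (intro bounded_linear_compose[OF bounded_linear_vec_nth bounded_linear_snd])
  have "C_class_on k (\<lambda>x. \<Sum>i\<in>UNIV. (snd x $ i) *\<^sub>R J i (rad (snd p) x)) U"
    using assms
    by (intro C_class_on_sum C_class_on_scaleR[OF open_U C_class_on_linear_functional[OF lin open_U]]
          C_class_on_bounded_linear[OF bounded_linear_J] open_U C_class_on_rad) auto
  hence "C_class_on k (\<lambda>x. rad (fst p) x + vJ (snd x) (rad (snd p) x)) U"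
    using assms unfolding vJ_def by (intro C_class_on_add[OF open_U] C_class_on_rad) auto
  thus ?thesis by (simp add: Ax_def[abs_def])
qed

section \<open>Axial form, and slice hyperholomorphic functions as axial functions\<close>

lemma even_odd_on_Ax:
  assumes "p \<in> EE"
  shows "even_odd_on V (fst p) (\<lambda>q. snd q *\<^sub>R snd p q)"
  using assms even_smoothD(2) by (fastforce simp: even_odd_on_def)

text \<open>The odd component is recovered as |y| times the second entry. At real points the
  direction is 0 by convention and y vanishes, so both sides agree.\<close>

lemma Ax_axial_form:
  "Ax p x = fst p (fst x, norm (snd x)) +
     vJ (snd x /\<^sub>R norm (snd x)) (norm (snd x) *\<^sub>R snd p (fst x, norm (snd x)))"
  by (cases "snd x = 0") (simp_all add: Ax_def rad_def vJ_simps)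

text \<open>With \<beta> = v c the equation for the u-derivative of \<alpha> becomes P a = c + v^2 Q
  c. The other reads v Q a = - v P c, from which \<open>op_Q_eqI\<close> removes the factor v even
  on the axis.\<close>

lemma holomorphic_pair_Ax:
  assumes hp: "holomorphic_pair V \<alpha> \<beta>"
    and f: "\<And>I u v. norm I = 1 \<Longrightarrow> (u, v) \<in> V \<Longrightarrow> f (u, v *\<^sub>R I) = \<alpha> (u, v) + vJ I (\<beta> (u, v))"
  obtains a c where "(a, c) \<in> EE" "\<And>x. x \<in> U \<Longrightarrow> f x = Ax (a, c) x"
    "op_P V a = c + op_M (op_Q V c)" "op_Q V a = - op_P V c"
proof -
  have eo: "\<alpha> (u, - v) = \<alpha> (u, v)" "\<beta> (u, - v) = - \<beta> (u, v)" if "(u, v) \<in> V" for u v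
    using hp that by (auto simp: holomorphic_pair_def even_odd_on_def)
  have "CR_pair V \<alpha> \<beta>" using hp by (simp add: holomorphic_pair_def CR_pair_def)
  hence s: "smooth_on V \<alpha>" "smooth_on V \<beta>"
    using CR_pair_C_class_on[OF open_V] by (auto simp: smooth_on_def)
  define a where "a = restr V \<alpha>"
  define c where "c = restr V (quot_v \<beta>)"
  have a: "a \<in> even_smooth V" unfolding a_def by (rule even_smooth_restrI[OF s(1) eo(1)])
  have c: "c \<in> even_smooth V" unfolding c_def by (rule quot_v_in[OF s(2) eo(2)])
  have \<beta>: "\<beta> q = snd q *\<^sub>R c q" if "q \<in> V" for q
    using that eo(2)[of "fst q" 0] eq_neg_imp_eq_0[of "\<beta> (fst q, 0)"]
    by (cases q) (auto simp: c_def restr_def quot_v_def)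
  have f_Ax: "f x = Ax (a, c) x" if x: "x \<in> U" for x
  proof -
    note xV = norm_mem_slice_domain[OF axial_U x]
    \<comment> \<open>At a real point every direction is admissible, as the vector term vanishes
      there.\<close>
    obtain I where I: "norm I = 1" "snd x = norm (snd x) *\<^sub>R I"
    proof (cases "snd x = 0")
      case True
      show ?thesis by (rule that[of "axis undefined 1"]) (use True in auto)
    next
      case False
      show ?thesis by (rule that[of "snd x /\<^sub>R norm (snd x)"]) (use False in auto)
    qed
    have "f x = f (fst x, norm (snd x) *\<^sub>R I)" using I(2) by (metis prod.collapse)
    also have "\<dots> = a (fst x, norm (snd x)) + vJ I (norm (snd x) *\<^sub>R c (fst x, norm (snd x)))"
      using f[OF I(1) xV] \<beta>[OF xV] xV by (simp add: a_def restr_def)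
    also have "\<dots> = Ax (a, c) x"
      using I(2) by (metis (no_types, lifting) Ax_def fst_conv rad_def snd_conv vJ_simps(2,4))
    finally show ?thesis .
  qed
  have b: "(1, 0) \<in> (Basis :: (real \<times> real) set)" "(0, 1) \<in> (Basis :: (real \<times> real) set)"
    by (simp_all add: Basis_real2)
  have du: "partial_deriv (1, 0) \<beta> q = snd q *\<^sub>R op_P V c q" if q: "q \<in> V" for q
  proof -
    have "has_partial_deriv (1, 0) (\<lambda>q. snd q *\<^sub>R c q) q (snd q *\<^sub>R op_P V c q)"
      using bounded_linear.has_vector_derivative[OF bounded_linear_scaleR_right has_partial_u[OF c q], of "snd q"]
      by simp
    hence "has_partial_deriv (1, 0) \<beta> q (snd q *\<^sub>R op_P V c q)"
      by (rule has_partial_deriv_transform[OF _ open_V q]) (simp add: \<beta>)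
    thus ?thesis by (rule partial_deriv_eqI)
  qed
  have dv: "partial_deriv (0, 1) \<beta> q = c q + op_M (op_Q V c) q" if q: "q \<in> V" for q
  proof -
    have "((\<lambda>t. snd q + t) has_field_derivative 1) (at 0)"
      by (auto intro!: derivative_eq_intros)
    from has_vector_derivative_scaleR[OF this has_partial_v[OF c q]]
    have "has_partial_deriv (0, 1) (\<lambda>q. snd q *\<^sub>R c q) q (c q + op_M (op_Q V c) q)"
      by (simp add: op_M_def add.commute flip: zero_prod_def)
    hence "has_partial_deriv (0, 1) \<beta> q (c q + op_M (op_Q V c) q)"
      by (rule has_partial_deriv_transform[OF _ open_V q]) (simp add: \<beta>)
    thus ?thesis by (rule partial_deriv_eqI)
  qed
  have cr: "partial_deriv (1, 0) \<alpha> q = partial_deriv (0, 1) \<beta> q"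
    "partial_deriv (0, 1) \<alpha> q = - partial_deriv (1, 0) \<beta> q" if "q \<in> V" for q
    using hp that by (auto simp: holomorphic_pair_def)
  have \<alpha>: "has_partial_deriv h a q (partial_deriv h \<alpha> q)" if "h \<in> Basis" "q \<in> V" for h q
    by (rule has_partial_deriv_transform[OF smooth_on_has_partial_deriv[OF s(1) that] open_V that(2)])
      (simp add: a_def restr_def)
  have "op_P V a = c + op_M (op_Q V c)"
  proof (rule op_P_eqI)
    fix q assume q: "q \<in> V"
    show "has_partial_deriv (1, 0) a q ((c + op_M (op_Q V c)) q)"
      using \<alpha>[OF b(1) q] unfolding cr(1)[OF q] dv[OF q] plus_fun_apply .
  qed (rule subspace_add[OF subspace_even_smooth c op_M_in[OF op_Q_in[OF c]]])
  moreover have "op_Q V a = - op_P V c"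
  proof (rule op_Q_eqI[OF a subspace_neg[OF subspace_even_smooth op_P_in[OF c]]])
    fix q assume q: "q \<in> V"
    show "has_partial_deriv (0, 1) a q (snd q *\<^sub>R (- op_P V c) q)"
      using \<alpha>[OF b(2) q] unfolding cr(2)[OF q] du[OF q] fun_Compl_def scaleR_minus_right .
  qed
  ultimately show ?thesis using a c by (intro that[OF _ f_Ax]) auto
qed

end

section \<open>Polyanalyticity\<close>

context axial_domain
begin

lemma Ax_polyanalytic:
  assumes p: "p \<in> EE" and g: "\<And>x. x \<in> U \<Longrightarrow> g x = Ax p x"
    and zero: "(DD (real CARD('n)) ^^ m) p = (0, 0)"
  shows "C_class_on k g U" "\<And>x. x \<in> U \<Longrightarrow> (DJ ^^ m) g x = 0"
    "\<exists>A B. even_odd_on V A B \<and> (\<forall>x\<in>U. g x = A (fst x, norm (snd x)) +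
       vJ (snd x /\<^sub>R norm (snd x)) (B (fst x, norm (snd x))))"
proof -
  show "C_class_on k g U"
    by (rule C_class_on_transform[OF C_class_on_Ax[OF p] open_U]) (simp add: g)
  show "(DJ ^^ m) g x = 0" if "x \<in> U" for x
    using funpow_Ax(1)[OF p g that, of m] zero by (simp add: Ax_def rad_def vJ_zero)
  show "\<exists>A B. even_odd_on V A B \<and> (\<forall>x\<in>U. g x = A (fst x, norm (snd x)) +
       vJ (snd x /\<^sub>R norm (snd x)) (B (fst x, norm (snd x))))"
    using even_odd_on_Ax[OF p] Ax_axial_form[of p] g
    by (intro exI[of _ "fst p"] exI[of _ "\<lambda>q. snd q *\<^sub>R snd p q"]) auto
qed

text \<open>Operators written to the right of f act in reading order, so the right case applies the
  Laplacian first and the left case last. One pair represents both, since \<open>DL\<close> and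
  \<open>DB\<close> commute.\<close>

lemma holomorphic_pair_polyanalytic:
  assumes hp: "holomorphic_pair V \<alpha> \<beta>"
    and f: "\<And>I u v. norm I = 1 \<Longrightarrow> (u, v) \<in> V \<Longrightarrow> f (u, v *\<^sub>R I) = \<alpha> (u, v) + vJ I (\<beta> (u, v))"
    and n: "CARD('n) = 2 * (l + m) + 1" and lm: "l + m \<ge> 1"
  obtains p where "p \<in> EE" "(DD (real CARD('n)) ^^ Suc m) p = (0, 0)"
    "\<And>x. x \<in> U \<Longrightarrow> (laplacian ^^ l) ((DJbar ^^ m) f) x = Ax p x"
    "\<And>x. x \<in> U \<Longrightarrow> (DJbar ^^ m) ((laplacian ^^ l) f) x = Ax p x"
proof -
  obtain a c where p: "(a, c) \<in> EE" and f: "\<And>x. x \<in> U \<Longrightarrow> f x = Ax (a, c) x"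
    and ac: "op_P V a = c + op_M (op_Q V c)" "op_Q V a = - op_P V c"
    using holomorphic_pair_Ax[OF hp f] by metis
  define N where "N = real CARD('n)"
  define q where "q = (DL N ^^ l) ((DB N ^^ m) (a, c))"
  have N: "N = 2 * real (l + m) + 1" using n by (simp add: N_def)
  show ?thesis
  proof (rule that)
    show "q \<in> EE" unfolding q_def by (intro funpow_pair_ops_in p)
    show "(DD (real CARD('n)) ^^ Suc m) q = (0, 0)"
      unfolding q_def N_def[symmetric] using p by (intro funpow_DD_holomorphic ac lm N) auto
    fix x assume x: "x \<in> U"
    show "(laplacian ^^ l) ((DJbar ^^ m) f) x = Ax q x"
      unfolding q_def N_def
      by (rule funpow_Ax(3)[OF funpow_pair_ops_in(2)[OF p] funpow_Ax(2)[OF p f] x])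
    have "(DJbar ^^ m) ((laplacian ^^ l) f) x = Ax ((DB N ^^ m) ((DL N ^^ l) (a, c))) x"
      unfolding N_def
      by (rule funpow_Ax(2)[OF funpow_pair_ops_in(3)[OF p] funpow_Ax(3)[OF p f] x])
    thus "(DJbar ^^ m) ((laplacian ^^ l) f) x = Ax q x"
      by (simp add: q_def funpow_DB_funpow_DL[OF p])
  qed
qed

end

section \<open>Left and right multiplication by the generators\<close>

lemma e_gen_square: "e_gen i * e_gen i = (- 1 :: 'n::{finite,linorder} clifford)"
proof -
  have "2 *\<^sub>R (e_gen i * e_gen i) = 2 *\<^sub>R (- 1 :: 'n clifford)"
    using e_gen_anticommute[of i i] by (simp add: scaleR_2)
  thus ?thesis by (rule scaleR_left_imp_eq [rotated]) simp
qed

lemma e_gen_swap: "i \<noteq> j \<Longrightarrow> e_gen i * e_gen j = - (e_gen j * e_gen i :: 'n::{finite,linorder} clifford)"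
  using e_gen_anticommute[of i j] by (simp add: eq_neg_iff_add_eq_0)

lemma clifford_action_left: "clifford_action (\<lambda>i (a :: 'n::{finite,linorder} clifford). e_gen i * a)"
proof (rule clifford_action.intro)
  show "bounded_linear (\<lambda>a :: 'n clifford. e_gen i * a)" for i
    by (intro linear_conv_bounded_linear[THEN iffD1] linearI) (simp_all add: distrib_left)
  show "e_gen i * (e_gen i * a) = - a" for i and a :: "'n clifford"
    unfolding mult.assoc[symmetric] e_gen_square by simp
  show "e_gen i * (e_gen j * a) = - (e_gen j * (e_gen i * a))" if "i \<noteq> j" for i j and a :: "'n clifford"
    unfolding mult.assoc[symmetric] e_gen_swap[OF that] by simp
qed

lemma clifford_action_right: "clifford_action (\<lambda>i (a :: 'n::{finite,linorder} clifford). a * e_gen i)"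
proof (rule clifford_action.intro)
  show "bounded_linear (\<lambda>a :: 'n clifford. a * e_gen i)" for i
    by (intro linear_conv_bounded_linear[THEN iffD1] linearI) (simp_all add: distrib_right)
  show "a * e_gen i * e_gen i = - a" for i and a :: "'n clifford"
    unfolding mult.assoc e_gen_square by simp
  show "a * e_gen j * e_gen i = - (a * e_gen i * e_gen j)" if "i \<noteq> j" for i j and a :: "'n clifford"
    unfolding mult.assoc e_gen_swap[OF that] by simp
qed

theorem theorem8p3:
  fixes U :: "'n::{finite,linorder} point set"
    and f :: "'n point \<Rightarrow> 'n clifford"
    and h l :: nat
  assumes "odd CARD('n)"
    and "h = (CARD('n) - 1) div 2"
    and "int l \<le> int h - 1"
    and "open U"
    and "axially_symmetric U"
  shows "(left_slice_hyperholomorphic U f \<longrightarrow>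
            left_axially_polyanalytic (h - l + 1) U
              ((laplacian ^^ l) ((Dbar_left ^^ (h - l)) f))) \<and>
         (right_slice_hyperholomorphic U f \<longrightarrow>
            right_axially_polyanalytic (h - l + 1) U
              ((Dbar_right ^^ (h - l)) ((laplacian ^^ l) f)))"
proof (intro conjI impI)
  define m where "m = h - l"
  \<comment> \<open>The bound on \<open>l\<close> forces \<open>h \<ge> 1\<close> and makes the
    subtraction \<open>h - l\<close> exact, so that \<open>l + m = h\<close>.\<close>
  have lm: "l + m \<ge> 1" and n: "CARD('n) = 2 * (l + m) + 1"
    using assms(1-3) by (auto simp: m_def elim!: oddE)
  have m: "h - l + 1 = Suc m" "h - l = m" by (simp_all add: m_def)
  {
    interpret L: axial_domain "\<lambda>i (a :: 'n clifford). e_gen i * a" U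
      by (intro axial_domain.intro clifford_action_left axial_domain_axioms.intro assms)
    have D: "D_left = L.DJ" "Dbar_left = L.DJbar"
      by (intro ext, simp add: D_left_def Dbar_left_def L.DJ_def L.DJbar_def)+
    have v: "L.vJ y a = vec_embed y * a" for y a
      by (simp add: L.vJ_def vec_embed_def sum_distrib_right)
    assume "left_slice_hyperholomorphic U f"
    then obtain \<alpha> \<beta> where hp: "holomorphic_pair (slice_domain U) \<alpha> \<beta>"
      and f: "\<And>I u v. norm I = 1 \<Longrightarrow> (u, v) \<in> slice_domain U \<Longrightarrow>
        f (u, v *\<^sub>R I) = \<alpha> (u, v) + L.vJ I (\<beta> (u, v))"
      unfolding left_slice_hyperholomorphic_def v by fastforce
    obtain p where "p \<in> L.EE" "(L.DD (real CARD('n)) ^^ Suc m) p = (0, 0)"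
      "\<And>x. x \<in> U \<Longrightarrow> (laplacian ^^ l) ((Dbar_left ^^ m) f) x = L.Ax p x"
      using L.holomorphic_pair_polyanalytic[OF hp f n lm] unfolding D by metis
    from L.Ax_polyanalytic[OF this(1,3,2)]
    show "left_axially_polyanalytic (h - l + 1) U ((laplacian ^^ l) ((Dbar_left ^^ (h - l)) f))"
      unfolding m(1) unfolding left_axially_polyanalytic_def left_axial_form_def D v m(2) by blast
  next
    interpret R: axial_domain "\<lambda>i (a :: 'n clifford). a * e_gen i" U
      by (intro axial_domain.intro clifford_action_right axial_domain_axioms.intro assms)
    have D: "D_right = R.DJ" "Dbar_right = R.DJbar"
      by (intro ext, simp add: D_right_def Dbar_right_def R.DJ_def R.DJbar_def)+
    have v: "R.vJ y a = a * vec_embed y" for y a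
      by (simp add: R.vJ_def vec_embed_def sum_distrib_left)
    assume "right_slice_hyperholomorphic U f"
    then obtain \<alpha> \<beta> where hp: "holomorphic_pair (slice_domain U) \<alpha> \<beta>"
      and f: "\<And>I u v. norm I = 1 \<Longrightarrow> (u, v) \<in> slice_domain U \<Longrightarrow>
        f (u, v *\<^sub>R I) = \<alpha> (u, v) + R.vJ I (\<beta> (u, v))"
      unfolding right_slice_hyperholomorphic_def v by fastforce
    obtain p where "p \<in> R.EE" "(R.DD (real CARD('n)) ^^ Suc m) p = (0, 0)"
      "\<And>x. x \<in> U \<Longrightarrow> (Dbar_right ^^ m) ((laplacian ^^ l) f) x = R.Ax p x"
      using R.holomorphic_pair_polyanalytic[OF hp f n lm] unfolding D by metis
    from R.Ax_polyanalytic[OF this(1,3,2)]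
    show "right_axially_polyanalytic (h - l + 1) U ((Dbar_right ^^ (h - l)) ((laplacian ^^ l) f))"
      unfolding m(1) unfolding right_axially_polyanalytic_def right_axial_form_def D v m(2) by blast
  }
qed

end
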